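(* Let $\zeta_1(y)$ and $\zeta_2(y)$ be two arbitrary functions defined on an open interval $(c,d)\subset\mathbb{R}$ (possibly $\mathbb{R}$), with $\zeta_2(y)\neq0$ for all $y\in(c,d)$. Then all the eight $p$-minimal surfaces $$S_I^-(\zeta_1),\ S_I^+(\zeta_1),\ S_{II}^-(\zeta_1),\ S_{II}^+(\zeta_1),\ \Sigma_I(\zeta_1,\zeta_2),\ \Sigma_{II}^-(\zeta_1,\zeta_2),\ \Sigma_{II}^+(\zeta_1,\zeta_2),\ \Sigma_{III}(\zeta_1,\zeta_2)$$ (where $\Sigma_I$ is considered when $\zeta_2>0$ and $\Sigma_{II}^\pm,\Sigma_{III}$ when $\zeta_2<0$) are immersed. In addition they are maximal in the following sense (up to Heisenberg rigid motions): - Any connected $p$-minimal surface of special type I with $\zeta_1(y)$ as the $\zeta_1$-invariant is a part of either $S_I^-(\zeta_1)$ or $S_I^+(\zeta_1)$. - Any connected $p$-minimal surface of special type II with $\zeta_1(y)$ as the $\zeta_1$-invariant is a part of either $S_{II}^-(\zeta_1)$ or $S_{II}^+(\zeta_1)$. - Any connected $p$-minimal surface of type I with $\zeta_1(y)$ and $\zeta_2(y)$ as the $\zeta_1$- and $\zeta_2$-invariants is a part of $\Sigma_I(\zeta_1,\zeta_2)$. - Any connected $p$-minimal surface of type II with $\zeta_1(y)$ and $\zeta_2(y)$ as the $\zeta_1$- and $\zeta_2$-invariants is a part of either $\Sigma_{II}^-(\zeta_1,\zeta_2)$ or $\Sigma_{II}^+(\zeta_1,\zeta_2)$. - Any connected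 $p$-minimal surface of type III with $\zeta_1(y)$ and $\zeta_2(y)$ as the $\zeta_1$- and $\zeta_2$-invariants is a part of $\Sigma_{III}(\zeta_1,\zeta_2)$.
   Context: The Heisenberg group $H_1$ is $\mathbb{R}^3$ with the group law $(x_1,y_1,z_1)\circ(x_2,y_2,z_2)=(x_1+x_2,\,y_1+y_2,\,z_1+z_2+y_1x_2-x_1y_2)$. Left invariant fields: $\mathring e_1=\partial_x+y\partial_z$, $\mathring e_2=\partial_y-x\partial_z$, $T=\partial_z$. Contact form $\Theta=dz+x\,dy-y\,dx$, contact bundle $\xi=\ker\Theta$, $J\mathring e_1=\mathring e_2$, $J\mathring e_2=-\mathring e_1$. The adapted metric makes $\mathring e_1,\mathring e_2,T$ orthonormal; $\nabla$ is the connection for which they are parallel. A Heisenberg rigid motion is a diffeomorphism of $H_1$ preserving $(J,\Theta)$. All objects are $C^\infty$. For a surface (possibly immersed) in $H_1$, a point is singular if the tangent plane equals $\xi_p$, otherwise regular. On the regular part choose a unit tangent field $e_1\in\xi$ (characteristic direction, up to sign), $e_2=Je_1$; $H$ is defined by $\nabla_{e_1}e_2=-He_1$; $p$-minimal means $H=0$ on the regular part. The $\alpha$-function is defined by requiring $\alpha e_2+T$ to be tangent; $\hat e_1=e_1$, $\hat e_2=\frac{\alpha e_2+T}{\sqrt{1+\alpha^2}}$. Compatible coordinates: $e_1=\partial_x$, $\hat e_2=a\,\partial_x+b\,\partial_y$, $b>0$. Coordinates $(x,y)$, $y\in(c,d)$, on a $p$-minimal surface without singular points are normal, with $\zeta_1$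 (and $\zeta_2$) as invariants, if they are compatible, $a=0$, and: (special type I) $\alpha=\frac1{x+\zeta_1(y)}$, $b=\frac{\alpha^2}{\sqrt{1+\alpha^2}}$; (special type II) $\alpha=\frac1{2x+\zeta_1(y)}$, $b=\frac{|\alpha|}{\sqrt{1+\alpha^2}}$; (general type) $\alpha=\frac{x+\zeta_1(y)}{(x+\zeta_1(y))^2+\zeta_2(y)}$, $\zeta_2\ne0$, $b=\frac{|\alpha|}{|x+\zeta_1(y)|\sqrt{1+\alpha^2}}$ (i.e. $b=\frac{1}{|(x+\zeta_1)^2+\zeta_2|\sqrt{1+\alpha^2}}$). A surface of general type is of type I if $\zeta_2>0$; of type II if $\zeta_2<0$ and either $x<-\zeta_1-\sqrt{-\zeta_2}$ or $x>-\zeta_1+\sqrt{-\zeta_2}$; of type III if $\zeta_2<0$ and $-\zeta_1-\sqrt{-\zeta_2}<x<-\zeta_1+\sqrt{-\zeta_2}$. A surface "with $\zeta_1$ (and $\zeta_2$) as invariants" is one described by such normal coordinates. Maximal domains (all with $y\in(c,d)$): $U_I^\mp=\{x+\zeta_1(y)<0\}$, resp. $\{x+\zeta_1(y)>0\}$; $U_{II}^\mp=\{2x+\zeta_1(y)<0\}$, resp. $\{2x+\zeta_1(y)>0\}$; if $\zeta_2>0$: $V_I=\mathbb{R}\times(c,d)$; if $\zeta_2<0$: $V_{II}^-=\{x<-\zeta_1(y)-\sqrt{-\zeta_2(y)}\}$, $V_{II}^+=\{x>-\zeta_1(y)+\sqrt{-\zeta_2(y)}\}$, $V_{III}=\{-\zeta_1(y)-\sqrt{-\zeta_2(y)}<x<-\zeta_1(y)+\sqrt{-\zeta_2(y)}\}$.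 The surfaces $S_I^\pm(\zeta_1)=X(U_I^\pm)$, $S_{II}^\pm(\zeta_1)=X(U_{II}^\pm)$, $\Sigma_I=X(V_I)$, $\Sigma_{II}^\pm=X(V_{II}^\pm)$, $\Sigma_{III}=X(V_{III})$ are the $p$-minimal surfaces (unique up to a Heisenberg rigid motion) given by maps $X$ of these domains into $H_1$ for which $(x,y)$ are normal coordinates of special type I, special type II, and general type respectively, with invariants $\zeta_1$ (and $\zeta_2$). *)

theory Defs
  imports "HOL-Analysis.Analysis"
begin

section \<open>Smooth maps\<close>

text \<open>\<open>Ck_on k S f\<close> says that \<open>f\<close> is of class \<open>C^k\<close> on the open set \<open>S\<close>: its iterated directional
  derivatives up to order \<open>k\<close> exist (as Frechet derivatives) and are continuous.\<close>

fun Ck_on :: "nat \<Rightarrow> 'a::real_normed_vector set \<Rightarrow> ('a \<Rightarrow> 'b::real_normed_vector) \<Rightarrow> bool" where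
  "Ck_on 0 S f \<longleftrightarrow> continuous_on S f"
| "Ck_on (Suc k) S f \<longleftrightarrow>
     (\<forall>q\<in>S. f differentiable (at q)) \<and> (\<forall>v. Ck_on k S (\<lambda>q. frechet_derivative f (at q) v))"

definition smooth_on :: "'a::real_normed_vector set \<Rightarrow> ('a \<Rightarrow> 'b::real_normed_vector) \<Rightarrow> bool" where
  "smooth_on S f \<longleftrightarrow> open S \<and> (\<forall>k. Ck_on k S f)"


section \<open>The Heisenberg group\<close>

text \<open>Points and tangent vectors are both triples with respect to the coordinates \<open>(x,y,z)\<close>.
  The frame \<open>heis_E1, heis_E2, heis_T\<close> is left invariant for the group law
  \<open>(x1,y1,z1) (x2,y2,z2) = (x1 + x2, y1 + y2, z1 + z2 + y1 x2 - x1 y2)\<close>.\<close>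

type_synonym heis = "real \<times> real \<times> real"

definition heis_E1 :: "heis \<Rightarrow> heis" where
  "heis_E1 = (\<lambda>(x, y, z). (1, 0, y))"

definition heis_E2 :: "heis \<Rightarrow> heis" where
  "heis_E2 = (\<lambda>(x, y, z). (0, 1, - x))"

definition heis_T :: heis where
  "heis_T = (0, 0, 1)"

definition contact_form :: "heis \<Rightarrow> heis \<Rightarrow> real" where
  "contact_form = (\<lambda>(x, y, z) (v1, v2, v3). v3 + x * v2 - y * v1)"

definition contact_plane :: "heis \<Rightarrow> heis set" where
  "contact_plane p = {v. contact_form p v = 0}"

text \<open>Every tangent vector \<open>v\<close> at \<open>p\<close> is
  \<open>frame_coef1 v *\<^sub>R heis_E1 p + frame_coef2 v *\<^sub>R heis_E2 p + contact_form p v *\<^sub>R heis_T\<close>.\<close>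

definition frame_coef1 :: "heis \<Rightarrow> real" where
  "frame_coef1 v = fst v"

definition frame_coef2 :: "heis \<Rightarrow> real" where
  "frame_coef2 v = fst (snd v)"

text \<open>Only the restriction of \<open>heis_J p\<close> to \<open>contact_plane p\<close> is meaningful.\<close>

definition heis_J :: "heis \<Rightarrow> heis \<Rightarrow> heis" where
  "heis_J p v = frame_coef1 v *\<^sub>R heis_E2 p - frame_coef2 v *\<^sub>R heis_E1 p"

definition heis_metric :: "heis \<Rightarrow> heis \<Rightarrow> heis \<Rightarrow> real" where
  "heis_metric p u v =
     frame_coef1 u * frame_coef1 v + frame_coef2 u * frame_coef2 v + contact_form p u * contact_form p v"

definition rigid_motion :: "(heis \<Rightarrow> heis) \<Rightarrow> bool" where
  "rigid_motion \<Phi> \<longleftrightarrow>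
     bij \<Phi> \<and> smooth_on UNIV \<Phi> \<and> smooth_on UNIV (inv \<Phi>) \<and>
     (\<forall>p v. contact_form (\<Phi> p) (frechet_derivative \<Phi> (at p) v) = contact_form p v) \<and>
     (\<forall>p. \<forall>v\<in>contact_plane p.
        frechet_derivative \<Phi> (at p) (heis_J p v) = heis_J (\<Phi> p) (frechet_derivative \<Phi> (at p) v))"


section \<open>Parametrized surfaces\<close>

text \<open>A possibly immersed surface carrying global coordinates \<open>(x,y)\<close> with values in an open
  \<open>U \<subseteq> \<real>\<^sup>2\<close> is represented by the map \<open>X : U \<rightarrow> H\<^sub>1\<close> in these coordinates. Vector fields along the
  surface are functions of the parameter \<open>q \<in> U\<close> with \<open>e q\<close> a tangent vector of \<open>H\<^sub>1\<close> at \<open>X q\<close>.\<close>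

definition immersion_on :: "(real \<times> real) set \<Rightarrow> (real \<times> real \<Rightarrow> heis) \<Rightarrow> bool" where
  "immersion_on U X \<longleftrightarrow> smooth_on U X \<and> (\<forall>q\<in>U. inj (frechet_derivative X (at q)))"

definition tangent_plane :: "(real \<times> real \<Rightarrow> heis) \<Rightarrow> real \<times> real \<Rightarrow> heis set" where
  "tangent_plane X q = range (frechet_derivative X (at q))"

definition singular_at :: "(real \<times> real \<Rightarrow> heis) \<Rightarrow> real \<times> real \<Rightarrow> bool" where
  "singular_at X q \<longleftrightarrow> tangent_plane X q = contact_plane (X q)"

definition characteristic_field ::
  "(real \<times> real) set \<Rightarrow> (real \<times> real \<Rightarrow> heis) \<Rightarrow> (real \<times> real \<Rightarrow> heis) \<Rightarrow> bool" where
  "characteristic_field W X e \<longleftrightarrow>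
     smooth_on W e \<and>
     (\<forall>q\<in>W. e q \<in> tangent_plane X q \<inter> contact_plane (X q) \<and> heis_metric (X q) (e q) (e q) = 1)"

text \<open>Covariant derivative, in the parameter direction \<open>w\<close>, of a field \<open>V\<close> along \<open>X\<close>, for the
  connection with \<open>heis_E1\<close>, \<open>heis_E2\<close>, \<open>heis_T\<close> parallel.\<close>

definition cov_deriv ::
  "(real \<times> real \<Rightarrow> heis) \<Rightarrow> (real \<times> real \<Rightarrow> heis) \<Rightarrow> real \<times> real \<Rightarrow> real \<times> real \<Rightarrow> heis" where
  "cov_deriv X V q w =
     frechet_derivative (\<lambda>s. frame_coef1 (V s)) (at q) w *\<^sub>R heis_E1 (X q) +
     frechet_derivative (\<lambda>s. frame_coef2 (V s)) (at q) w *\<^sub>R heis_E2 (X q) +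
     frechet_derivative (\<lambda>s. contact_form (X s) (V s)) (at q) w *\<^sub>R heis_T"

text \<open>\<open>H\<close> is the p-mean curvature with respect to the characteristic field \<open>e\<close>:
  \<open>\<nabla>\<^bsub>e\<^esub> (J e) = - H e\<close>.\<close>

definition p_mean_curvature ::
  "(real \<times> real) set \<Rightarrow> (real \<times> real \<Rightarrow> heis) \<Rightarrow> (real \<times> real \<Rightarrow> heis) \<Rightarrow> (real \<times> real \<Rightarrow> real) \<Rightarrow> bool" where
  "p_mean_curvature W X e H \<longleftrightarrow>
     (\<forall>q\<in>W. \<forall>w. frechet_derivative X (at q) w = e q \<longrightarrow>
        cov_deriv X (\<lambda>s. heis_J (X s) (e s)) q w = - H q *\<^sub>R e q)"

text \<open>The characteristic field is only determined up to sign and in general only exists locally,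
  hence the quantification over open pieces \<open>W\<close> of the regular part.\<close>

definition p_minimal_on :: "(real \<times> real) set \<Rightarrow> (real \<times> real \<Rightarrow> heis) \<Rightarrow> bool" where
  "p_minimal_on U X \<longleftrightarrow>
     (\<forall>W e. open W \<and> W \<subseteq> {q\<in>U. \<not> singular_at X q} \<and> characteristic_field W X e \<longrightarrow>
        p_mean_curvature W X e (\<lambda>_. 0))"

definition alpha_function ::
  "(real \<times> real) set \<Rightarrow> (real \<times> real \<Rightarrow> heis) \<Rightarrow> (real \<times> real \<Rightarrow> heis) \<Rightarrow> (real \<times> real \<Rightarrow> real) \<Rightarrow> bool" where
  "alpha_function U X e1 \<alpha> \<longleftrightarrow>
     (\<forall>q\<in>U. \<alpha> q *\<^sub>R heis_J (X q) (e1 q) + heis_T \<in> tangent_plane X q)"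

definition e2_hat ::
  "(real \<times> real \<Rightarrow> heis) \<Rightarrow> (real \<times> real \<Rightarrow> heis) \<Rightarrow> (real \<times> real \<Rightarrow> real) \<Rightarrow> real \<times> real \<Rightarrow> heis" where
  "e2_hat X e1 \<alpha> q = (1 / sqrt (1 + (\<alpha> q)\<^sup>2)) *\<^sub>R (\<alpha> q *\<^sub>R heis_J (X q) (e1 q) + heis_T)"

definition compatible_coords ::
  "(real \<times> real) set \<Rightarrow> (real \<times> real \<Rightarrow> heis) \<Rightarrow> (real \<times> real \<Rightarrow> heis) \<Rightarrow>
   (real \<times> real \<Rightarrow> real) \<Rightarrow> (real \<times> real \<Rightarrow> real) \<Rightarrow> (real \<times> real \<Rightarrow> real) \<Rightarrow> bool" where
  "compatible_coords U X e1 \<alpha> a b \<longleftrightarrow>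
     characteristic_field U X e1 \<and> alpha_function U X e1 \<alpha> \<and>
     (\<forall>q\<in>U. e1 q = frechet_derivative X (at q) (1, 0) \<and>
            e2_hat X e1 \<alpha> q = frechet_derivative X (at q) (a q, b q) \<and> b q > 0)"


section \<open>Normal coordinates\<close>

text \<open>\<open>I\<close> is the range \<open>(c,d)\<close> of the variable \<open>y\<close>. The map \<open>X\<close> is only required to be smooth here;
  that it is an immersion is stated separately.\<close>

definition normal_coords ::
  "real set \<Rightarrow> (real \<times> real \<Rightarrow> real) \<Rightarrow> (real \<times> real \<Rightarrow> real) \<Rightarrow>
   (real \<times> real) set \<Rightarrow> (real \<times> real \<Rightarrow> heis) \<Rightarrow> bool" where
  "normal_coords I \<alpha> b U X \<longleftrightarrow>
     smooth_on U X \<and> U \<subseteq> UNIV \<times> I \<and>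
     (\<forall>q\<in>U. \<not> singular_at X q) \<and> p_minimal_on U X \<and>
     (\<exists>e1. compatible_coords U X e1 \<alpha> (\<lambda>_. 0) b)"

definition special_type_I ::
  "real set \<Rightarrow> (real \<Rightarrow> real) \<Rightarrow> (real \<times> real) set \<Rightarrow> (real \<times> real \<Rightarrow> heis) \<Rightarrow> bool" where
  "special_type_I I \<zeta>1 U X \<longleftrightarrow>
     (\<forall>(x, y)\<in>U. x + \<zeta>1 y \<noteq> 0) \<and>
     (let \<alpha> = \<lambda>(x, y). 1 / (x + \<zeta>1 y)
      in normal_coords I \<alpha> (\<lambda>q. (\<alpha> q)\<^sup>2 / sqrt (1 + (\<alpha> q)\<^sup>2)) U X)"

definition special_type_II ::
  "real set \<Rightarrow> (real \<Rightarrow> real) \<Rightarrow> (real \<times> real) set \<Rightarrow> (real \<times> real \<Rightarrow> heis) \<Rightarrow> bool" where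
  "special_type_II I \<zeta>1 U X \<longleftrightarrow>
     (\<forall>(x, y)\<in>U. 2 * x + \<zeta>1 y \<noteq> 0) \<and>
     (let \<alpha> = \<lambda>(x, y). 1 / (2 * x + \<zeta>1 y)
      in normal_coords I \<alpha> (\<lambda>q. \<bar>\<alpha> q\<bar> / sqrt (1 + (\<alpha> q)\<^sup>2)) U X)"

text \<open>For general type, \<open>b = \<bar>\<alpha>\<bar> / (\<bar>x + \<zeta>1\<bar> sqrt (1 + \<alpha>\<^sup>2))\<close>, with the common factor \<open>\<bar>x + \<zeta>1\<bar>\<close>
  cancelled so that the formula also makes sense where \<open>x + \<zeta>1 = 0\<close>.\<close>

definition general_type ::
  "real set \<Rightarrow> (real \<Rightarrow> real) \<Rightarrow> (real \<Rightarrow> real) \<Rightarrow> (real \<times> real) set \<Rightarrow> (real \<times> real \<Rightarrow> heis) \<Rightarrow> bool" where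
  "general_type I \<zeta>1 \<zeta>2 U X \<longleftrightarrow>
     (\<forall>(x, y)\<in>U. \<zeta>2 y \<noteq> 0 \<and> (x + \<zeta>1 y)\<^sup>2 + \<zeta>2 y \<noteq> 0) \<and>
     (let \<alpha> = \<lambda>(x, y). (x + \<zeta>1 y) / ((x + \<zeta>1 y)\<^sup>2 + \<zeta>2 y);
          b = \<lambda>(x, y). 1 / (\<bar>(x + \<zeta>1 y)\<^sup>2 + \<zeta>2 y\<bar> * sqrt (1 + (\<alpha> (x, y))\<^sup>2))
      in normal_coords I \<alpha> b U X)"

definition type_I ::
  "real set \<Rightarrow> (real \<Rightarrow> real) \<Rightarrow> (real \<Rightarrow> real) \<Rightarrow> (real \<times> real) set \<Rightarrow> (real \<times> real \<Rightarrow> heis) \<Rightarrow> bool" where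
  "type_I I \<zeta>1 \<zeta>2 U X \<longleftrightarrow> general_type I \<zeta>1 \<zeta>2 U X \<and> (\<forall>(x, y)\<in>U. \<zeta>2 y > 0)"

definition type_II ::
  "real set \<Rightarrow> (real \<Rightarrow> real) \<Rightarrow> (real \<Rightarrow> real) \<Rightarrow> (real \<times> real) set \<Rightarrow> (real \<times> real \<Rightarrow> heis) \<Rightarrow> bool" where
  "type_II I \<zeta>1 \<zeta>2 U X \<longleftrightarrow> general_type I \<zeta>1 \<zeta>2 U X \<and>
     (\<forall>(x, y)\<in>U. \<zeta>2 y < 0 \<and> (x < - \<zeta>1 y - sqrt (- \<zeta>2 y) \<or> x > - \<zeta>1 y + sqrt (- \<zeta>2 y)))"

definition type_III ::
  "real set \<Rightarrow> (real \<Rightarrow> real) \<Rightarrow> (real \<Rightarrow> real) \<Rightarrow> (real \<times> real) set \<Rightarrow> (real \<times> real \<Rightarrow> heis) \<Rightarrow> bool" where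
  "type_III I \<zeta>1 \<zeta>2 U X \<longleftrightarrow> general_type I \<zeta>1 \<zeta>2 U X \<and>
     (\<forall>(x, y)\<in>U. \<zeta>2 y < 0 \<and> - \<zeta>1 y - sqrt (- \<zeta>2 y) < x \<and> x < - \<zeta>1 y + sqrt (- \<zeta>2 y))"


section \<open>Maximal domains\<close>

definition U_I_minus :: "real set \<Rightarrow> (real \<Rightarrow> real) \<Rightarrow> (real \<times> real) set" where
  "U_I_minus I \<zeta>1 = {(x, y). y \<in> I \<and> x + \<zeta>1 y < 0}"

definition U_I_plus :: "real set \<Rightarrow> (real \<Rightarrow> real) \<Rightarrow> (real \<times> real) set" where
  "U_I_plus I \<zeta>1 = {(x, y). y \<in> I \<and> x + \<zeta>1 y > 0}"

definition U_II_minus :: "real set \<Rightarrow> (real \<Rightarrow> real) \<Rightarrow> (real \<times> real) set" where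
  "U_II_minus I \<zeta>1 = {(x, y). y \<in> I \<and> 2 * x + \<zeta>1 y < 0}"

definition U_II_plus :: "real set \<Rightarrow> (real \<Rightarrow> real) \<Rightarrow> (real \<times> real) set" where
  "U_II_plus I \<zeta>1 = {(x, y). y \<in> I \<and> 2 * x + \<zeta>1 y > 0}"

definition V_I :: "real set \<Rightarrow> (real \<times> real) set" where
  "V_I I = UNIV \<times> I"

definition V_II_minus :: "real set \<Rightarrow> (real \<Rightarrow> real) \<Rightarrow> (real \<Rightarrow> real) \<Rightarrow> (real \<times> real) set" where
  "V_II_minus I \<zeta>1 \<zeta>2 = {(x, y). y \<in> I \<and> x < - \<zeta>1 y - sqrt (- \<zeta>2 y)}"

definition V_II_plus :: "real set \<Rightarrow> (real \<Rightarrow> real) \<Rightarrow> (real \<Rightarrow> real) \<Rightarrow> (real \<times> real) set" where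
  "V_II_plus I \<zeta>1 \<zeta>2 = {(x, y). y \<in> I \<and> x > - \<zeta>1 y + sqrt (- \<zeta>2 y)}"

definition V_III :: "real set \<Rightarrow> (real \<Rightarrow> real) \<Rightarrow> (real \<Rightarrow> real) \<Rightarrow> (real \<times> real) set" where
  "V_III I \<zeta>1 \<zeta>2 =
     {(x, y). y \<in> I \<and> - \<zeta>1 y - sqrt (- \<zeta>2 y) < x \<and> x < - \<zeta>1 y + sqrt (- \<zeta>2 y)}"

text \<open>Up to a rigid motion the surface \<open>Y : U \<rightarrow> H\<^sub>1\<close> is the restriction to \<open>U \<subseteq> V\<close> of \<open>X : V \<rightarrow> H\<^sub>1\<close>;
  in particular \<open>Y ` U \<subseteq> \<Phi> ` X ` V\<close>.\<close>

definition part_of ::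
  "(real \<times> real) set \<Rightarrow> (real \<times> real \<Rightarrow> heis) \<Rightarrow> (real \<times> real) set \<Rightarrow> (real \<times> real \<Rightarrow> heis) \<Rightarrow> bool" where
  "part_of U Y V X \<longleftrightarrow> U \<subseteq> V \<and> (\<exists>\<Phi>. rigid_motion \<Phi> \<and> (\<forall>q\<in>U. Y q = \<Phi> (X q)))"

end

theory Submission
  imports Defs
begin

text \<open>Put \<open>f = 1 / (b * sqrt (1 + \<alpha>\<^sup>2))\<close> and \<open>g = \<alpha> * f\<close>. In normal coordinates
  \<open>\<partial>X/\<partial>x = c E1 + s E2\<close> and \<open>\<partial>X/\<partial>y = f (\<alpha> e2 + T)\<close> with \<open>c\<^sup>2 + s\<^sup>2 = 1\<close>; p-minimality says that \<open>c, s\<close> do not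
  depend on \<open>x\<close>, and equality of mixed derivatives gives \<open>\<partial>(c, s)/\<partial>y = (\<partial>g/\<partial>x) (- s, c)\<close>. Since \<open>\<alpha>\<close> and \<open>b\<close> alone
  determine this linear system, two surfaces with the same \<open>\<alpha>\<close> and \<open>b\<close> on a connected domain have
  characteristic fields that differ by a constant rotation; after applying it the surfaces
  differ by a constant left translation. The \<open>T\<close>-component \<open>f > 0\<close> of \<open>\<partial>X/\<partial>y\<close> makes them immersed. In all
  eight cases \<open>f = k x\<^sup>2 + 2 m(y) x + n(y)\<close> and \<open>g = k x + m(y)\<close> with \<open>k \<in> {0, 1, - 1}\<close>, and
  then the equations are solved explicitly by straight lines at angle \<open>k y\<close>, up to antiderivatives
  in \<open>y\<close>.\<close>

section \<open>Calculus of smooth maps\<close>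

text \<open>The derivatives are full ones at points of an open set, so they only see values inside
  \<open>S\<close>; equality on \<open>S\<close> thus passes to each directional derivative, and the
  induction runs over all pairs of functions.\<close>

lemma Ck_on_cong:
  assumes "open S" "\<And>q. q \<in> S \<Longrightarrow> f q = g q" "Ck_on k S f"
  shows "Ck_on k S g"
  using assms(2,3)
proof (induction k arbitrary: f g)
  case 0
  then show ?case by (simp cong: continuous_on_cong)
next
  case (Suc k)
  have D: "(g has_derivative frechet_derivative f (at q)) (at q)" if "q \<in> S" for q
  proof (rule has_derivative_transform_within_open[OF _ assms(1) that])
    show "(f has_derivative frechet_derivative f (at q)) (at q)"
      using Suc.prems(2) that by (simp add: frechet_derivative_works[symmetric])
  qed (use Suc.prems(1) in auto)
  have "frechet_derivative f (at q) = frechet_derivative g (at q)" if "q \<in> S" for q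
    by (rule frechet_derivative_at[OF D[OF that]])
  then have "Ck_on k S (\<lambda>q. frechet_derivative g (at q) v)" for v
    using Suc.prems by (intro Suc.IH[of "\<lambda>q. frechet_derivative f (at q) v" "\<lambda>q. frechet_derivative g (at q) v"]) auto
  then show ?case
    using differentiableI[OF D] by simp
qed

text \<open>\<open>frechet_derivative\<close> is a choice operator; uniqueness of derivatives lets
  an explicitly computed \<open>f'\<close> stand in for it. All later smoothness proofs by
  differentiation go through this rule.\<close>

lemma Ck_on_SucI:
  assumes "open S" "\<And>q. q \<in> S \<Longrightarrow> (f has_derivative f' q) (at q)" "\<And>v. Ck_on k S (\<lambda>q. f' q v)"
  shows "Ck_on (Suc k) S f"
proof -
  have "f' q v = frechet_derivative f (at q) v" if "q \<in> S" for q v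
    using frechet_derivative_at[OF assms(2)[OF that]] by simp
  then have "Ck_on k S (\<lambda>q. frechet_derivative f (at q) v)" for v
    by (rule Ck_on_cong[OF assms(1) _ assms(3)])
  then show ?thesis
    using differentiableI[OF assms(2)] by simp
qed

lemma Ck_on_SucD:
  assumes "Ck_on (Suc k) S f"
  shows "q \<in> S \<Longrightarrow> (f has_derivative frechet_derivative f (at q)) (at q)"
    and "Ck_on k S (\<lambda>q. frechet_derivative f (at q) v)"
  using assms by (auto simp: frechet_derivative_works)

text \<open>\<open>Ck_on\<close> demands continuity only at the last order. Lower orders follow
  because differentiability implies continuity, applied at order zero and carried upwards along
  directional derivatives.\<close>

lemma Ck_on_Suc_imp:
  assumes "Ck_on (Suc k) S f"
  shows "Ck_on k S f"
  using assms
proof (induction k arbitrary: f)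
  case 0
  then show ?case
    by (auto intro!: continuous_at_imp_continuous_on differentiable_imp_continuous_within)
next
  case (Suc k)
  have "\<forall>v. Ck_on k S (\<lambda>q. frechet_derivative f (at q) v)"
    using Suc by (metis Ck_on_SucD(2))
  then show ?case
    using Suc.prems by auto
qed

lemma Ck_on_const [simp]: "Ck_on k S (\<lambda>q. c)"
  by (induction k arbitrary: c) auto

lemma Ck_on_bounded_linear_compose:
  assumes "bounded_linear L" "open S" "Ck_on k S f"
  shows "Ck_on k S (\<lambda>q. L (f q))"
  using assms(3)
proof (induction k arbitrary: f)
  case 0
  then show ?case
    using assms(1) by (simp add: bounded_linear.continuous_on)
next
  case (Suc k)
  show ?case
    using Ck_on_SucD[OF Suc.prems] Suc.IH
    by (intro Ck_on_SucI[OF assms(2), where f' = "\<lambda>q v. L (frechet_derivative f (at q) v)"]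
        bounded_linear.has_derivative[OF assms(1)]) auto
qed

lemma Ck_on_bounded_linear:
  assumes "bounded_linear L" "open S"
  shows "Ck_on k S L"
proof (cases k)
  case 0
  then show ?thesis
    using assms(1) by (simp add: linear_continuous_on)
next
  case (Suc j)
  then show ?thesis
    using Ck_on_SucI[OF assms(2) bounded_linear_imp_has_derivative[OF assms(1)], of j] by simp
qed

lemma Ck_on_add:
  assumes "open S" "Ck_on k S f" "Ck_on k S g"
  shows "Ck_on k S (\<lambda>q. f q + g q)"
  using assms(2,3)
proof (induction k arbitrary: f g)
  case 0
  then show ?case by (simp add: continuous_on_add)
next
  case (Suc k)
  show ?case
    using Ck_on_SucD[OF Suc.prems(1)] Ck_on_SucD[OF Suc.prems(2)] Suc.IH
    by (intro Ck_on_SucI[OF assms(1), where f' = "\<lambda>q v. frechet_derivative f (at q) v + frechet_derivative g (at q) v"]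
        has_derivative_add) auto
qed

lemma Ck_on_mult:
  fixes f g :: "'a::real_normed_vector \<Rightarrow> real"
  assumes "open S" "Ck_on k S f" "Ck_on k S g"
  shows "Ck_on k S (\<lambda>q. f q * g q)"
  using assms(2,3)
proof (induction k arbitrary: f g)
  case 0
  then show ?case by (simp add: continuous_on_mult)
next
  case (Suc k)
  show ?case
    \<comment> \<open>Each summand of the product rule keeps one factor undifferentiated, so that
      factor must first be lowered from order \<open>Suc k\<close> to order
      \<open>k\<close>.\<close>
    using Ck_on_SucD[OF Suc.prems(1)] Ck_on_SucD[OF Suc.prems(2)] Suc.IH
      Suc.prems[THEN Ck_on_Suc_imp]
    by (intro Ck_on_SucI[OF assms(1), where f' = "\<lambda>q v. f q * frechet_derivative g (at q) v + frechet_derivative f (at q) v * g q"]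
        has_derivative_mult Ck_on_add[OF assms(1)]) auto
qed

text \<open>Since \<open>h\<close> has one real variable, its derivative is multiplication by a
  number, and the chain rule produces a product of \<open>h' (f q)\<close> with a derivative of
  \<open>f\<close>. The induction varies \<open>h\<close> because its derivative takes its place,
  while \<open>f\<close> stays.\<close>

lemma Ck_on_compose:
  fixes f :: "'a::real_normed_vector \<Rightarrow> real" and h :: "real \<Rightarrow> real"
  assumes "open S" "f ` S \<subseteq> I" "Ck_on k S f" "Ck_on k I h"
  shows "Ck_on k S (\<lambda>q. h (f q))"
  using assms(3,4)
proof (induction k arbitrary: h)
  case 0
  then show ?case
    using assms(2) by (auto intro: continuous_on_compose2)
next
  case (Suc k)
  have "((\<lambda>q. h (f q)) has_derivative
      (\<lambda>v. frechet_derivative h (at (f q)) 1 * frechet_derivative f (at q) v)) (at q)" if "q \<in> S" for q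
  proof -
    have h: "(h has_derivative frechet_derivative h (at (f q))) (at (f q))"
      using Ck_on_SucD(1)[OF Suc.prems(2)] assms(2) that by blast
    have "frechet_derivative h (at (f q)) t = frechet_derivative h (at (f q)) 1 * t" for t
      using linear_scale[OF has_derivative_linear[OF h], of t 1] by (simp add: mult.commute)
    then show ?thesis
      by (intro has_derivative_eq_rhs[OF has_derivative_compose[OF Ck_on_SucD(1)[OF Suc.prems(1) that] h]] ext)
  qed
  moreover have "Ck_on k S (\<lambda>q. frechet_derivative h (at (f q)) 1 * frechet_derivative f (at q) v)" for v
    by (rule Ck_on_mult[OF assms(1) Suc.IH[OF Suc.prems(1)[THEN Ck_on_Suc_imp] Ck_on_SucD(2)[OF Suc.prems(2)]]
          Ck_on_SucD(2)[OF Suc.prems(1)]])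
  ultimately show ?case
    by (rule Ck_on_SucI[OF assms(1)])
qed

text \<open>Each function is, up to sign, the derivative of the other, so the induction has to treat
  both at once.\<close>

lemma Ck_on_cos_sin: "Ck_on k UNIV (cos :: real \<Rightarrow> real) \<and> Ck_on k UNIV (sin :: real \<Rightarrow> real)"
proof (induction k)
  case 0
  then show ?case by (simp add: continuous_on_cos continuous_on_sin)
next
  case (Suc k)
  have "Ck_on (Suc k) UNIV (sin :: real \<Rightarrow> real)"
    using Suc by (intro Ck_on_SucI[of _ _ "\<lambda>x v. cos x * v"])
      (auto intro!: derivative_eq_intros Ck_on_mult)
  moreover have "Ck_on (Suc k) UNIV (cos :: real \<Rightarrow> real)"
  proof (intro Ck_on_SucI[of _ _ "\<lambda>x v. sin x * (- v)"])
    show "Ck_on k UNIV (\<lambda>x. sin x * - v)" for v :: real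
      using Suc by (intro Ck_on_mult) auto
  qed (auto intro!: derivative_eq_intros)
  ultimately show ?case by blast
qed

section \<open>Algebra of smooth maps\<close>

lemma smooth_on_open: "smooth_on S f \<Longrightarrow> open S"
  by (simp add: smooth_on_def)

lemma smooth_on_cong:
  assumes "smooth_on S f" "\<And>q. q \<in> S \<Longrightarrow> f q = g q"
  shows "smooth_on S g"
  using assms Ck_on_cong[of S f g] unfolding smooth_on_def by blast

lemma smooth_on_has_derivative:
  assumes "smooth_on S f" "q \<in> S"
  shows "(f has_derivative frechet_derivative f (at q)) (at q)"
  using assms Ck_on_SucD(1) unfolding smooth_on_def by blast

lemma smooth_on_frechet_derivative:
  assumes "smooth_on S f"
  shows "smooth_on S (\<lambda>q. frechet_derivative f (at q) v)"
  using assms Ck_on_SucD(2) unfolding smooth_on_def by blast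

lemma smooth_on_imp_continuous_on: "smooth_on S f \<Longrightarrow> continuous_on S f"
  unfolding smooth_on_def using Ck_on.simps(1) by blast

lemma smooth_on_const: "open S \<Longrightarrow> smooth_on S (\<lambda>q. c)"
  by (simp add: smooth_on_def)

lemma smooth_on_bounded_linear: "bounded_linear L \<Longrightarrow> open S \<Longrightarrow> smooth_on S L"
  by (simp add: smooth_on_def Ck_on_bounded_linear)

lemma smooth_on_bounded_linear_compose:
  "bounded_linear L \<Longrightarrow> smooth_on S f \<Longrightarrow> smooth_on S (\<lambda>q. L (f q))"
  by (simp add: smooth_on_def Ck_on_bounded_linear_compose)

lemma smooth_on_add: "smooth_on S f \<Longrightarrow> smooth_on S g \<Longrightarrow> smooth_on S (\<lambda>q. f q + g q)"
  by (simp add: smooth_on_def Ck_on_add)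

lemma smooth_on_mult:
  fixes f g :: "'a::real_normed_vector \<Rightarrow> real"
  shows "smooth_on S f \<Longrightarrow> smooth_on S g \<Longrightarrow> smooth_on S (\<lambda>q. f q * g q)"
  by (simp add: smooth_on_def Ck_on_mult)

lemma smooth_on_minus: "smooth_on S f \<Longrightarrow> smooth_on S (\<lambda>q. - f q)"
  by (rule smooth_on_bounded_linear_compose[OF bounded_linear_minus[OF bounded_linear_ident]])

lemma smooth_on_diff: "smooth_on S f \<Longrightarrow> smooth_on S g \<Longrightarrow> smooth_on S (\<lambda>q. f q - g q)"
  using smooth_on_add[of S f "\<lambda>q. - g q"] smooth_on_minus[of S g] by simp

lemma smooth_on_compose:
  fixes f :: "'a::real_normed_vector \<Rightarrow> real" and h :: "real \<Rightarrow> real"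
  assumes "smooth_on I h" "smooth_on S f" "f ` S \<subseteq> I"
  shows "smooth_on S (\<lambda>q. h (f q))"
  using assms unfolding smooth_on_def by (metis Ck_on_compose)

lemma smooth_on_cos:
  fixes f :: "'a::real_normed_vector \<Rightarrow> real"
  shows "smooth_on S f \<Longrightarrow> smooth_on S (\<lambda>q. cos (f q))"
  by (rule smooth_on_compose[of UNIV]) (auto simp: smooth_on_def Ck_on_cos_sin)

lemma smooth_on_sin:
  fixes f :: "'a::real_normed_vector \<Rightarrow> real"
  shows "smooth_on S f \<Longrightarrow> smooth_on S (\<lambda>q. sin (f q))"
  by (rule smooth_on_compose[of UNIV]) (auto simp: smooth_on_def Ck_on_cos_sin)

lemma smooth_on_Pair:
  assumes "smooth_on S f" "smooth_on S g"
  shows "smooth_on S (\<lambda>q. (f q, g q))"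
proof -
  \<comment> \<open>The pair is the sum of its images under the two linear embeddings of the
    factors.\<close>
  have "smooth_on S (\<lambda>q. (f q, 0) + (0, g q))"
    by (rule smooth_on_add[OF
          smooth_on_bounded_linear_compose[OF bounded_linear_Pair[OF bounded_linear_ident bounded_linear_zero] assms(1)]
          smooth_on_bounded_linear_compose[OF bounded_linear_Pair[OF bounded_linear_zero bounded_linear_ident] assms(2)]])
  then show ?thesis by simp
qed

lemmas smooth_on_intros =
  smooth_on_const smooth_on_add smooth_on_diff smooth_on_minus smooth_on_mult
  smooth_on_cos smooth_on_sin smooth_on_Pair

text \<open>If the derivative is of class C^k, the function is of class C^(k+1); here this holds for
  every \<open>k\<close>.\<close>

lemma smooth_on_antiderivative:
  fixes F f :: "real \<Rightarrow> real"
  assumes "smooth_on I f" "\<And>y. y \<in> I \<Longrightarrow> (F has_real_derivative f y) (at y)"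
  shows "smooth_on I F"
proof -
  have "Ck_on (Suc k) I F" for k
    using assms unfolding smooth_on_def
    by (intro Ck_on_SucI[of _ _ "\<lambda>y v. f y * v"] Ck_on_mult) (auto simp: has_field_derivative_def)
  then show ?thesis
    using assms(1) Ck_on_Suc_imp unfolding smooth_on_def by blast
qed

text \<open>Extended real endpoints cover bounded intervals, half-lines and the whole line at
  once.\<close>

lemma smooth_antiderivative_exists:
  fixes c d :: ereal and f :: "real \<Rightarrow> real"
  assumes "c < d" "smooth_on (einterval c d) f"
  obtains F where "\<And>y. y \<in> einterval c d \<Longrightarrow> (F has_real_derivative f y) (at y)"
    and "smooth_on (einterval c d) F"
proof -
  have "isCont f y" if "c < ereal y" "ereal y < d" for y
    using smooth_on_imp_continuous_on[OF assms(2)] that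
    by (simp add: continuous_on_eq_continuous_at[OF open_einterval] einterval_iff)
  then obtain F where "\<forall>y. c < ereal y \<longrightarrow> ereal y < d \<longrightarrow> (F has_vector_derivative f y) (at y)"
    using einterval_antiderivative[OF assms(1), of f] by blast
  then have "\<And>y. y \<in> einterval c d \<Longrightarrow> (F has_real_derivative f y) (at y)"
    by (simp add: einterval_def has_real_derivative_iff_has_vector_derivative)
  then show ?thesis
    using that smooth_on_antiderivative[OF assms(2)] by blast
qed

section \<open>Symmetry of second derivatives\<close>

text \<open>Two uses of the mean value theorem: first in direction \<open>u\<close> for the
  increment of \<open>f\<close> under \<open>h *\<^sub>R v\<close>, then in direction
  \<open>v\<close> for the derivative \<open>fu\<close> so obtained. The whole parallelogram must
  lie in \<open>U\<close>.\<close>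

lemma second_difference_mvt:
  fixes f :: "'a::real_normed_vector \<Rightarrow> real"
  assumes U: "Ck_on (Suc (Suc 0)) U f" and h: "0 < h"
    and sub: "\<And>s t. 0 \<le> s \<Longrightarrow> s \<le> h \<Longrightarrow> 0 \<le> t \<Longrightarrow> t \<le> h \<Longrightarrow> q + s *\<^sub>R u + t *\<^sub>R v \<in> U"
  obtains s t where "0 < s" "s < h" "0 < t" "t < h"
    "f (q + h *\<^sub>R u + h *\<^sub>R v) - f (q + h *\<^sub>R u) - f (q + h *\<^sub>R v) + f q
      = h * h * frechet_derivative (\<lambda>p. frechet_derivative f (at p) u) (at (q + s *\<^sub>R u + t *\<^sub>R v)) v"
proof -
  define fu where "fu = (\<lambda>p. frechet_derivative f (at p) u)"
  have D: "((\<lambda>r. g (a + r *\<^sub>R w)) has_real_derivative frechet_derivative g (at (a + r *\<^sub>R w)) w) (at r)"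
    if g: "(g has_derivative frechet_derivative g (at (a + r *\<^sub>R w))) (at (a + r *\<^sub>R w))"
    for g :: "'a \<Rightarrow> real" and a w r
  proof -
    have "((\<lambda>r. a + r *\<^sub>R w) has_derivative (\<lambda>r. r *\<^sub>R w)) (at r)"
      by (auto intro!: derivative_eq_intros)
    from has_derivative_compose[OF this g] show ?thesis
      unfolding has_field_derivative_def
      by (simp add: linear_scale[OF has_derivative_linear[OF g]] mult.commute[of _ "frechet_derivative _ _ _"])
  qed
  have f: "(f has_derivative frechet_derivative f (at p)) (at p)" if "p \<in> U" for p
    using Ck_on_SucD(1)[OF U that] .
  have fu: "(fu has_derivative frechet_derivative fu (at p)) (at p)" if "p \<in> U" for p
    unfolding fu_def using Ck_on_SucD(1)[OF Ck_on_SucD(2)[OF U] that] .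
  have "((\<lambda>r. f (q + h *\<^sub>R v + r *\<^sub>R u) - f (q + r *\<^sub>R u)) has_real_derivative
      fu (q + h *\<^sub>R v + r *\<^sub>R u) - fu (q + r *\<^sub>R u)) (at r)" if "0 \<le> r" "r \<le> h" for r
    unfolding fu_def using that h sub[of r h] sub[of r 0]
    by (intro DERIV_diff D f) (auto simp: algebra_simps)
  from MVT2[OF h this] obtain s where s: "0 < s" "s < h"
    "f (q + h *\<^sub>R v + h *\<^sub>R u) - f (q + h *\<^sub>R u) - (f (q + h *\<^sub>R v) - f q)
      = h * (fu (q + h *\<^sub>R v + s *\<^sub>R u) - fu (q + s *\<^sub>R u))"
    by auto
  have "((\<lambda>r. fu (q + s *\<^sub>R u + r *\<^sub>R v)) has_real_derivative
      frechet_derivative fu (at (q + s *\<^sub>R u + r *\<^sub>R v)) v) (at r)" if "0 \<le> r" "r \<le> h" for r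
    using that s sub[of s r] by (intro D fu) auto
  from MVT2[OF h this] obtain t where t: "0 < t" "t < h"
    "fu (q + s *\<^sub>R u + h *\<^sub>R v) - fu (q + s *\<^sub>R u)
      = h * frechet_derivative fu (at (q + s *\<^sub>R u + t *\<^sub>R v)) v"
    by auto
  show ?thesis
    using s t by (intro that[of s t]) (auto simp: algebra_simps fu_def)
qed

text \<open>The second difference is symmetric in \<open>u\<close> and \<open>v\<close>. Hence the
  two mixed derivatives agree at a pair of points, possibly different, arbitrarily close to
  \<open>q\<close>, and continuity of both forces equality at \<open>q\<close>.\<close>

lemma symmetric_second_derivative:
  fixes f :: "'a::real_normed_vector \<Rightarrow> real"
  assumes S: "open S" "q \<in> S" and f: "Ck_on (Suc (Suc 0)) S f"
  shows "frechet_derivative (\<lambda>p. frechet_derivative f (at p) u) (at q) v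
       = frechet_derivative (\<lambda>p. frechet_derivative f (at p) v) (at q) u"
proof (rule ccontr)
  let ?D = "\<lambda>u v p. frechet_derivative (\<lambda>p. frechet_derivative f (at p) u) (at p) v"
  assume ne: "?D u v q \<noteq> ?D v u q"
  \<comment> \<open>Half the supposed gap: numbers within \<open>e\<close> of the two different
    values can never coincide.\<close>
  define e where "e = \<bar>?D u v q - ?D v u q\<bar> / 2"
  have e: "e > 0" using ne by (simp add: e_def)
  have cont: "continuous_on S (?D u v)" for u v
    using Ck_on_SucD(2)[OF Ck_on_SucD(2)[OF f], of u v] by simp
  have lim: "(?D u v \<longlongrightarrow> ?D u v q) (nhds q)" for u v
  proof -
    have "isCont (?D u v) q"
      using cont[of u v] S by (simp add: continuous_on_eq_continuous_at)
    then show ?thesis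
      using tendsto_at_iff_tendsto_nhds[of "?D u v" q] by (simp add: isCont_def)
  qed
  have "\<forall>\<^sub>F p in nhds q. p \<in> S \<and> dist (?D u v p) (?D u v q) < e \<and> dist (?D v u p) (?D v u q) < e"
    by (intro eventually_conj eventually_nhds_in_open S tendstoD[OF lim e])
  then obtain r where r: "r > 0"
    "\<And>p. dist p q < r \<Longrightarrow> p \<in> S \<and> dist (?D u v p) (?D u v q) < e \<and> dist (?D v u p) (?D v u q) < e"
    by (auto simp: eventually_nhds_metric)
  \<comment> \<open>Small enough to keep the parallelogram inside the ball of radius
    \<open>r\<close>; the summand 1 keeps the denominator positive even for
    \<open>u = v = 0\<close>.\<close>
  define h where "h = r / (2 * (norm u + norm v + 1))"
  have pos: "norm u + norm v + 1 > 0" by (simp add: add_nonneg_pos)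
  have h: "h > 0" using r pos by (simp add: h_def)
  have near: "dist (q + s *\<^sub>R u + t *\<^sub>R v) q < r" if "0 \<le> s" "s \<le> h" "0 \<le> t" "t \<le> h" for s t
  proof -
    have "dist (q + s *\<^sub>R u + t *\<^sub>R v) q \<le> s * norm u + t * norm v"
      using norm_triangle_ineq[of "s *\<^sub>R u" "t *\<^sub>R v"] that by (simp add: dist_norm algebra_simps)
    also have "\<dots> \<le> h * norm u + h * norm v"
      using that by (intro add_mono mult_right_mono) auto
    also have "\<dots> < h * (2 * (norm u + norm v + 1))"
      using h by (simp add: algebra_simps add_pos_nonneg add_nonneg_pos)
    also have "\<dots> = r"
      using pos by (simp add: h_def)
    finally show ?thesis .
  qed
  have near': "dist (q + s *\<^sub>R v + t *\<^sub>R u) q < r" if "0 \<le> s" "s \<le> h" "0 \<le> t" "t \<le> h" for s t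
    using near[of t s] that by (simp add: algebra_simps)
  obtain s t where 1: "0 < s" "s < h" "0 < t" "t < h"
    "f (q + h *\<^sub>R u + h *\<^sub>R v) - f (q + h *\<^sub>R u) - f (q + h *\<^sub>R v) + f q
      = h * h * ?D u v (q + s *\<^sub>R u + t *\<^sub>R v)"
    using second_difference_mvt[OF f h, of q u v] near r(2) by metis
  obtain s' t' where 2: "0 < s'" "s' < h" "0 < t'" "t' < h"
    "f (q + h *\<^sub>R v + h *\<^sub>R u) - f (q + h *\<^sub>R v) - f (q + h *\<^sub>R u) + f q
      = h * h * ?D v u (q + s' *\<^sub>R v + t' *\<^sub>R u)"
    using second_difference_mvt[OF f h, of q v u] near' r(2) by metis
  have "h * h * ?D u v (q + s *\<^sub>R u + t *\<^sub>R v) = h * h * ?D v u (q + s' *\<^sub>R v + t' *\<^sub>R u)"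
    unfolding 1(5)[symmetric] 2(5)[symmetric] by (simp add: algebra_simps)
  then have "?D u v (q + s *\<^sub>R u + t *\<^sub>R v) = ?D v u (q + s' *\<^sub>R v + t' *\<^sub>R u)"
    using h by simp
  moreover have "dist (?D u v (q + s *\<^sub>R u + t *\<^sub>R v)) (?D u v q) < e"
    using r(2)[OF near[of s t]] 1 by simp
  moreover have "dist (?D v u (q + s' *\<^sub>R v + t' *\<^sub>R u)) (?D v u q) < e"
    using r(2)[OF near'[of s' t']] 2 by simp
  moreover have False if "a = a'" "dist a x < \<bar>x - y\<bar> / 2" "dist a' y < \<bar>x - y\<bar> / 2" for a a' x y :: real
    using that dist_triangle3[of x y a] unfolding dist_real_def by simp
  ultimately show False
    unfolding e_def by blast
qed

section \<open>Rigid motions\<close>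

text \<open>For \<open>u\<^sup>2 + w\<^sup>2 = 1\<close> this is the rotation about the z-axis with
  cosine \<open>u\<close> and sine \<open>w\<close>, followed by left translation by
  \<open>(a, b, t)\<close>. It is affine in the coordinates.\<close>

definition heis_motion :: "real \<Rightarrow> real \<Rightarrow> real \<Rightarrow> real \<Rightarrow> real \<Rightarrow> heis \<Rightarrow> heis" where
  "heis_motion u w a b t = (\<lambda>(x, y, z). (a + (u * x - w * y), b + (w * x + u * y),
     t + z + b * (u * x - w * y) - a * (w * x + u * y)))"

definition heis_motion_linear :: "real \<Rightarrow> real \<Rightarrow> real \<Rightarrow> real \<Rightarrow> heis \<Rightarrow> heis" where
  "heis_motion_linear u w a b = (\<lambda>(x, y, z). (u * x - w * y, w * x + u * y,
     z + b * (u * x - w * y) - a * (w * x + u * y)))"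

lemma heis_motion_eq: "heis_motion u w a b t p = (a, b, t) + heis_motion_linear u w a b p"
  by (simp add: heis_motion_def heis_motion_linear_def split: prod.splits)

lemma bounded_linear_heis_motion_linear: "bounded_linear (heis_motion_linear u w a b)"
proof -
  have "linear (heis_motion_linear u w a b)"
    by (rule linearI) (auto simp: heis_motion_linear_def algebra_simps)
  then show ?thesis
    by (simp add: linear_conv_bounded_linear)
qed

lemma smooth_on_heis_motion: "smooth_on UNIV (heis_motion u w a b t)"
  unfolding heis_motion_eq[abs_def]
  by (intro smooth_on_add smooth_on_const smooth_on_bounded_linear bounded_linear_heis_motion_linear) auto

lemma frechet_derivative_heis_motion:
  "frechet_derivative (heis_motion u w a b t) (at p) = heis_motion_linear u w a b"
proof -
  have "(heis_motion u w a b t has_derivative heis_motion_linear u w a b) (at p)"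
    unfolding heis_motion_eq[abs_def]
    using bounded_linear_imp_has_derivative[OF bounded_linear_heis_motion_linear]
    by (auto intro!: derivative_eq_intros)
  then show ?thesis
    by (rule frechet_derivative_at[symmetric])
qed

text \<open>Rotations are group automorphisms, so the inverse rotates back and translates by the
  rotated-back inverse of \<open>(a, b, t)\<close>; this explains the parameters.\<close>

lemma heis_motion_inverse:
  assumes "u\<^sup>2 + w\<^sup>2 = 1"
  shows "heis_motion u (- w) (- (u * a + w * b)) (w * a - u * b) (- t) (heis_motion u w a b t p) = p"
proof -
  obtain x y z where p: "p = (x, y, z)" by (cases p)
  have "u * u + w * w = 1" using assms by (simp add: power2_eq_square)
  then show ?thesis
    unfolding p heis_motion_def by (simp, intro conjI) algebra+
qed

text \<open>Left translations preserve the whole frame. Rotations preserve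
  \<open>x dy - y dx\<close>, hence the contact form, and commute with the quarter turn
  \<open>J\<close>.\<close>

lemma rigid_motion_heis_motion:
  assumes uw: "u\<^sup>2 + w\<^sup>2 = 1"
  shows "rigid_motion (heis_motion u w a b t)"
proof -
  let ?F = "heis_motion u w a b t"
  let ?a = "- (u * a + w * b)" and ?b = "w * a - u * b"
  let ?G = "heis_motion u (- w) ?a ?b (- t)"
  have uw': "u * u + w * w = 1" using uw by (simp add: power2_eq_square)
  have GF: "?G (?F p) = p" for p
    using heis_motion_inverse[OF uw] .
  \<comment> \<open>Forming the inverse parameters twice returns the original ones, so the other
    composition is the same lemma applied to \<open>?G\<close>.\<close>
  have a: "- (u * ?a + - w * ?b) = a" and b: "- w * ?a - u * ?b = b"
    using uw' by algebra+
  have FG: "?F (?G p) = p" for p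
    using heis_motion_inverse[of u "- w" ?a ?b "- t" p] uw unfolding a b by simp
  have "bij ?F"
    using GF FG by (intro o_bij[of ?G]) auto
  moreover have "inv ?F = ?G"
    using GF FG by (intro inv_equality) auto
  moreover have "contact_form (?F p) (heis_motion_linear u w a b v) = contact_form p v" for p v
  proof -
    obtain x y z v1 v2 v3 where p: "p = (x, y, z)" and v: "v = (v1, v2, v3)" by (cases p, cases v) auto
    show ?thesis
      using uw' unfolding p v contact_form_def heis_motion_def heis_motion_linear_def
      by simp algebra
  qed
  moreover have "heis_motion_linear u w a b (heis_J p v) = heis_J (?F p) (heis_motion_linear u w a b v)" for p v
  proof -
    obtain x y z v1 v2 v3 where p: "p = (x, y, z)" and v: "v = (v1, v2, v3)" by (cases p, cases v) auto
    show ?thesis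
      using uw' unfolding p v heis_J_def heis_E1_def heis_E2_def frame_coef1_def frame_coef2_def
        heis_motion_def heis_motion_linear_def
      by simp algebra
  qed
  ultimately show ?thesis
    unfolding rigid_motion_def frechet_derivative_heis_motion by (simp add: smooth_on_heis_motion)
qed

section \<open>Structure equations in normal coordinates\<close>

lemma frechet_derivative_at_eq:
  "(f has_derivative f') (at x) \<Longrightarrow> frechet_derivative f (at x) v = f' v"
  using frechet_derivative_at[of f f' x] by simp

lemma contact_form_linear:
  "contact_form p (t *\<^sub>R v + t' *\<^sub>R v') = t * contact_form p v + t' * contact_form p v'"
  by (simp add: contact_form_def split_beta algebra_simps)

text \<open>Used contrapositively: one tangent vector with nonzero contact form makes the point
  regular.\<close>

lemma singular_at_contact_form:
  assumes "singular_at X q"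
  shows "contact_form (X q) (frechet_derivative X (at q) w) = 0"
  using assms unfolding singular_at_def tangent_plane_def contact_plane_def by blast

text \<open>With the characteristic field \<open>e1\<close> fixed as a parameter, the structure
  equations can be instantiated for two surfaces side by side.\<close>

locale surface_in_normal_coords =
  fixes \<alpha> b :: "real \<times> real \<Rightarrow> real" and U :: "(real \<times> real) set"
    and X :: "real \<times> real \<Rightarrow> heis" and e1 :: "real \<times> real \<Rightarrow> heis"
  assumes smooth_X: "smooth_on U X"
    and regular: "q \<in> U \<Longrightarrow> \<not> singular_at X q"
    and p_minimal: "p_minimal_on U X"
    and compatible: "compatible_coords U X e1 \<alpha> (\<lambda>_. 0) b"
begin

definition f :: "real \<times> real \<Rightarrow> real" where
  "f q = 1 / (b q * sqrt (1 + (\<alpha> q)\<^sup>2))"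

definition g :: "real \<times> real \<Rightarrow> real" where
  "g q = \<alpha> q * f q"

definition DX :: "real \<times> real \<Rightarrow> real \<times> real \<Rightarrow> heis" where
  "DX q = frechet_derivative X (at q)"

definition c :: "real \<times> real \<Rightarrow> real" where
  "c q = fst (DX q (1, 0))"

definition s :: "real \<times> real \<Rightarrow> real" where
  "s q = fst (snd (DX q (1, 0)))"

lemma open_U: "open U"
  using smooth_X by (rule smooth_on_open)

lemma b_pos: "q \<in> U \<Longrightarrow> b q > 0"
  using compatible by (simp add: compatible_coords_def)

lemma f_pos: "q \<in> U \<Longrightarrow> f q > 0"
  using b_pos by (simp add: f_def add_pos_nonneg)

lemma has_derivative_X: "q \<in> U \<Longrightarrow> (X has_derivative DX q) (at q)"
  unfolding DX_def using smooth_X by (rule smooth_on_has_derivative)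

lemma DX_eq: "q \<in> U \<Longrightarrow> DX q v = fst v *\<^sub>R DX q (1, 0) + snd v *\<^sub>R DX q (0, 1)"
proof -
  assume "q \<in> U"
  then have "linear (DX q)"
    using has_derivative_X has_derivative_linear by blast
  then have "DX q (fst v *\<^sub>R (1, 0) + snd v *\<^sub>R (0, 1))
      = fst v *\<^sub>R DX q (1, 0) + snd v *\<^sub>R DX q (0, 1)"
    by (simp only: linear_add linear_scale)
  then show ?thesis by simp
qed

lemma characteristic: "characteristic_field U X e1"
  using compatible by (simp add: compatible_coords_def)

lemma e1_eq: "q \<in> U \<Longrightarrow> e1 q = DX q (1, 0)"
  using compatible by (simp add: compatible_coords_def DX_def)

lemma contact_x: "q \<in> U \<Longrightarrow> contact_form (X q) (DX q (1, 0)) = 0"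
  using characteristic e1_eq by (auto simp: characteristic_field_def contact_plane_def)

lemma c_s_unit: "q \<in> U \<Longrightarrow> (c q)\<^sup>2 + (s q)\<^sup>2 = 1"
  using characteristic e1_eq contact_x
  by (auto simp: characteristic_field_def heis_metric_def c_def s_def frame_coef1_def frame_coef2_def
      power2_eq_square)

text \<open>Because \<open>a = 0\<close>, the compatibility condition reads
  \<open>e2_hat = b\<close> times the y-derivative of \<open>X\<close>; dividing by \<open>b\<close>
  turns the normalising root into \<open>f\<close>.\<close>

lemma DX_y:
  assumes "q \<in> U"
  shows "DX q (0, 1) = f q *\<^sub>R (\<alpha> q *\<^sub>R heis_J (X q) (DX q (1, 0)) + heis_T)"
proof -
  have "b q *\<^sub>R DX q (0, 1) = DX q (0, b q)"
    using DX_eq[OF assms, of "(0, b q)"] by simp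
  also have "\<dots> = e2_hat X e1 \<alpha> q"
    using compatible assms by (simp add: compatible_coords_def DX_def)
  finally have "(1 / b q) *\<^sub>R (b q *\<^sub>R DX q (0, 1)) = (1 / b q) *\<^sub>R e2_hat X e1 \<alpha> q"
    by simp
  then show ?thesis
    using b_pos[OF assms] e1_eq[OF assms] by (simp add: e2_hat_def f_def)
qed

lemma DX_y_components:
  assumes "q \<in> U"
  shows "fst (DX q (0, 1)) = - (g q * s q)" "fst (snd (DX q (0, 1))) = g q * c q"
    "contact_form (X q) (DX q (0, 1)) = f q"
  using DX_y[OF assms]
  by (cases "X q"; simp add: heis_J_def heis_E1_def heis_E2_def heis_T_def frame_coef1_def
      frame_coef2_def c_def s_def g_def contact_form_def algebra_simps)+

lemma immersion: "immersion_on U X"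
  unfolding immersion_on_def
proof (intro conjI ballI smooth_X)
  fix q assume q: "q \<in> U"
  have "linear (DX q)"
    using has_derivative_X[OF q] has_derivative_linear by blast
  moreover have "v = 0" if "DX q v = 0" for v
  proof -
    have 0: "fst v *\<^sub>R DX q (1, 0) + snd v *\<^sub>R DX q (0, 1) = 0"
      using DX_eq[OF q, of v] that by simp
    have "contact_form (X q) 0 = 0"
      by (simp add: contact_form_def split_beta)
    \<comment> \<open>The contact form kills the x-derivative, which is horizontal, and equals
      \<open>f q\<close> on the y-derivative.\<close>
    then have "snd v * f q = 0"
      using contact_x[OF q] DX_y_components(3)[OF q] arg_cong[OF 0, of "contact_form (X q)"]
      by (simp add: contact_form_linear)
    then have v: "snd v = 0"
      using f_pos[OF q] by simp
    then have "fst v *\<^sub>R DX q (1, 0) = 0"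
      using 0 by simp
    then have "fst v = 0 \<or> c q = 0 \<and> s q = 0"
      by (auto simp: c_def s_def)
    then show "v = 0"
      using c_s_unit[OF q] v by (auto simp: prod_eq_iff)
  qed
  ultimately show "inj (frechet_derivative X (at q))"
    by (simp add: DX_def linear_injective_0)
qed

lemma smooth_components:
  "smooth_on U (\<lambda>q. fst (DX q v))" "smooth_on U (\<lambda>q. fst (snd (DX q v)))"
  unfolding DX_def
  by (rule smooth_on_bounded_linear_compose[OF bounded_linear_fst smooth_on_frechet_derivative[OF smooth_X]],
      rule smooth_on_bounded_linear_compose[OF bounded_linear_fst
        smooth_on_bounded_linear_compose[OF bounded_linear_snd smooth_on_frechet_derivative[OF smooth_X]]])

lemma mixed_derivatives:
  assumes "q \<in> U"
  shows "frechet_derivative (\<lambda>q. fst (DX q u)) (at q) v = frechet_derivative (\<lambda>q. fst (DX q v)) (at q) u"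
    and "frechet_derivative (\<lambda>q. fst (snd (DX q u))) (at q) v
       = frechet_derivative (\<lambda>q. fst (snd (DX q v))) (at q) u"
proof -
  have *: "frechet_derivative (\<lambda>q. L (DX q u)) (at q) v = frechet_derivative (\<lambda>q. L (DX q v)) (at q) u"
    if L: "bounded_linear L" for L :: "heis \<Rightarrow> real"
  proof -
    have D: "frechet_derivative (\<lambda>q. L (X q)) (at p) w = L (DX p w)" if "p \<in> U" for p w
      by (rule frechet_derivative_at_eq[OF bounded_linear.has_derivative[OF L has_derivative_X[OF that]]])
    \<comment> \<open>The derivative of \<open>L (X q)\<close> equals \<open>L (DX p w)\<close> only
      on \<open>U\<close>; openness of \<open>U\<close> makes their derivatives at \<open>q\<close>
      agree as well.\<close>
    have "frechet_derivative (\<lambda>p. frechet_derivative (\<lambda>q. L (X q)) (at p) w) (at q)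
        = frechet_derivative (\<lambda>p. L (DX p w)) (at q)" for w
    proof (rule frechet_derivative_transform_within_open[OF _ open_U assms])
      have "smooth_on U (\<lambda>p. frechet_derivative (\<lambda>q. L (X q)) (at p) w)"
        by (rule smooth_on_frechet_derivative[OF smooth_on_bounded_linear_compose[OF L smooth_X]])
      then show "(\<lambda>p. frechet_derivative (\<lambda>q. L (X q)) (at p) w) differentiable at q"
        by (rule differentiableI[OF smooth_on_has_derivative[OF _ assms]])
    qed (rule D)
    moreover have "Ck_on (Suc (Suc 0)) U (\<lambda>q. L (X q))"
      using smooth_on_bounded_linear_compose[OF L smooth_X] unfolding smooth_on_def by blast
    ultimately show ?thesis
      using symmetric_second_derivative[OF open_U assms, of "\<lambda>q. L (X q)" u v] by simp
  qed
  show "frechet_derivative (\<lambda>q. fst (DX q u)) (at q) v = frechet_derivative (\<lambda>q. fst (DX q v)) (at q) u"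
    by (rule *) (rule bounded_linear_fst)
  show "frechet_derivative (\<lambda>q. fst (snd (DX q u))) (at q) v
      = frechet_derivative (\<lambda>q. fst (snd (DX q v))) (at q) u"
    by (rule *) (rule bounded_linear_compose[OF bounded_linear_fst bounded_linear_snd])
qed

lemma has_derivative_c_s:
  assumes "q \<in> U"
  shows "(c has_derivative frechet_derivative c (at q)) (at q)"
    and "(s has_derivative frechet_derivative s (at q)) (at q)"
  using smooth_on_has_derivative[OF smooth_components(1) assms, of "(1, 0)"]
    smooth_on_has_derivative[OF smooth_components(2) assms, of "(1, 0)"]
  unfolding c_def[abs_def, symmetric] s_def[abs_def, symmetric] by auto

text \<open>The rotated field \<open>J e1\<close> has frame components \<open>- s\<close> and
  \<open>c\<close>. Zero curvature makes it parallel along \<open>e1\<close>, which is the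
  x-direction, so these components have vanishing x-derivative.\<close>

lemma c_s_x:
  assumes q: "q \<in> U"
  shows "frechet_derivative c (at q) (1, 0) = 0" "frechet_derivative s (at q) (1, 0) = 0"
proof -
  \<comment> \<open>Every point is regular, so \<open>U\<close> itself is an admissible piece and
    \<open>e1\<close> an admissible field in the definition of p-minimality.\<close>
  have "p_mean_curvature U X e1 (\<lambda>_. 0)"
    using p_minimal open_U regular characteristic unfolding p_minimal_on_def by blast
  then have 0: "cov_deriv X (\<lambda>p. heis_J (X p) (e1 p)) q (1, 0) = 0"
    using q e1_eq unfolding p_mean_curvature_def DX_def by auto
  have J: "frame_coef1 (heis_J (X p) (e1 p)) = - s p" "frame_coef2 (heis_J (X p) (e1 p)) = c p" if "p \<in> U" for p
    using e1_eq[OF that]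
    by (cases "X p"; simp add: heis_J_def heis_E1_def heis_E2_def frame_coef1_def frame_coef2_def c_def s_def)+
  have "((\<lambda>p. frame_coef1 (heis_J (X p) (e1 p))) has_derivative (\<lambda>v. - frechet_derivative s (at q) v)) (at q)"
    using has_derivative_transform_within_open[OF has_derivative_minus[OF has_derivative_c_s(2)[OF q]] open_U q]
      J(1) by force
  then have 1: "frechet_derivative (\<lambda>p. frame_coef1 (heis_J (X p) (e1 p))) (at q) (1, 0)
      = - frechet_derivative s (at q) (1, 0)"
    by (rule frechet_derivative_at_eq)
  have "((\<lambda>p. frame_coef2 (heis_J (X p) (e1 p))) has_derivative frechet_derivative c (at q)) (at q)"
    using has_derivative_transform_within_open[OF has_derivative_c_s(1)[OF q] open_U q] J(2) by force
  then have 2: "frechet_derivative (\<lambda>p. frame_coef2 (heis_J (X p) (e1 p))) (at q) (1, 0)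
      = frechet_derivative c (at q) (1, 0)"
    by (rule frechet_derivative_at_eq)
  show "frechet_derivative s (at q) (1, 0) = 0"
    using arg_cong[OF 0, of fst] 1
    by (cases "X q") (simp add: cov_deriv_def heis_E1_def heis_E2_def heis_T_def)
  show "frechet_derivative c (at q) (1, 0) = 0"
    using arg_cong[OF 0, of "\<lambda>v. fst (snd v)"] 2
    by (cases "X q") (simp add: cov_deriv_def heis_E1_def heis_E2_def heis_T_def)
qed

text \<open>Regularity of \<open>g\<close> is read off from \<open>X\<close>: turning the horizontal
  part \<open>g\<close> times \<open>(- s, c)\<close> of the y-derivative back by the angle of
  \<open>(c, s)\<close> isolates \<open>g\<close>, which is therefore smooth.\<close>

lemma g_has_derivative:
  assumes q: "q \<in> U"
  shows "(g has_derivative frechet_derivative g (at q)) (at q)"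
proof -
  let ?h = "\<lambda>q. fst (snd (DX q (0, 1))) * c q - fst (DX q (0, 1)) * s q"
  have "smooth_on U ?h"
    unfolding c_def s_def by (intro smooth_on_diff smooth_on_mult smooth_components)
  moreover have "?h p = g p" if "p \<in> U" for p
  proof -
    have "?h p = g p * ((c p)\<^sup>2 + (s p)\<^sup>2)"
      using DX_y_components[OF that] by (simp add: power2_eq_square algebra_simps)
    then show ?thesis
      using c_s_unit[OF that] by simp
  qed
  ultimately have "smooth_on U g"
    using smooth_on_cong by blast
  then show ?thesis
    using q by (rule smooth_on_has_derivative)
qed

text \<open>The y-derivative of \<open>(c, s)\<close> is the x-derivative of \<open>g\<close> times
  \<open>(- s, c)\<close>, by symmetry of second derivatives; as \<open>c\<close> and
  \<open>s\<close> are constant in x, only \<open>g\<close> gets differentiated.\<close>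

lemma c_s_y:
  assumes q: "q \<in> U"
  shows "frechet_derivative c (at q) (0, 1) = - (frechet_derivative g (at q) (1, 0) * s q)"
    and "frechet_derivative s (at q) (0, 1) = frechet_derivative g (at q) (1, 0) * c q"
proof -
  have "((\<lambda>p. fst (DX p (0, 1))) has_derivative
      (\<lambda>v. - (g q * frechet_derivative s (at q) v + frechet_derivative g (at q) v * s q))) (at q)"
    using has_derivative_transform_within_open[OF
        has_derivative_minus[OF has_derivative_mult[OF g_has_derivative[OF q] has_derivative_c_s(2)[OF q]]] open_U q]
      DX_y_components(1) by force
  then have "frechet_derivative (\<lambda>p. fst (DX p (0, 1))) (at q) (1, 0)
      = - (g q * frechet_derivative s (at q) (1, 0) + frechet_derivative g (at q) (1, 0) * s q)"
    by (rule frechet_derivative_at_eq)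
  then show "frechet_derivative c (at q) (0, 1) = - (frechet_derivative g (at q) (1, 0) * s q)"
    using mixed_derivatives(1)[OF q, of "(1, 0)" "(0, 1)"] c_s_x(2)[OF q]
    by (simp add: c_def[abs_def])
  have "((\<lambda>p. fst (snd (DX p (0, 1)))) has_derivative
      (\<lambda>v. g q * frechet_derivative c (at q) v + frechet_derivative g (at q) v * c q)) (at q)"
    using has_derivative_transform_within_open[OF
        has_derivative_mult[OF g_has_derivative[OF q] has_derivative_c_s(1)[OF q]] open_U q]
      DX_y_components(2) by force
  then have "frechet_derivative (\<lambda>p. fst (snd (DX p (0, 1)))) (at q) (1, 0)
      = g q * frechet_derivative c (at q) (1, 0) + frechet_derivative g (at q) (1, 0) * c q"
    by (rule frechet_derivative_at_eq)
  then show "frechet_derivative s (at q) (0, 1) = frechet_derivative g (at q) (1, 0) * c q"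
    using mixed_derivatives(2)[OF q, of "(1, 0)" "(0, 1)"] c_s_x(1)[OF q]
    by (simp add: s_def[abs_def])
qed

lemma structure_equations:
  assumes q: "q \<in> U"
  shows "(c has_derivative (\<lambda>v. - (snd v * frechet_derivative g (at q) (1, 0) * s q))) (at q)"
    and "(s has_derivative (\<lambda>v. snd v * frechet_derivative g (at q) (1, 0) * c q)) (at q)"
    and "((\<lambda>p. fst (X p)) has_derivative (\<lambda>v. fst v * c q - snd v * (g q * s q))) (at q)"
    and "((\<lambda>p. fst (snd (X p))) has_derivative (\<lambda>v. fst v * s q + snd v * (g q * c q))) (at q)"
    and "((\<lambda>p. snd (snd (X p))) has_derivative (\<lambda>v. snd v * f q
          + fst (snd (X q)) * (fst v * c q - snd v * (g q * s q))
          - fst (X q) * (fst v * s q + snd v * (g q * c q)))) (at q)"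
proof -
  have lin: "F' v = fst v * F' (1, 0) + snd v * F' (0, 1)"
    if "(F has_derivative F') (at q)" for F :: "real \<times> real \<Rightarrow> real" and F' v
  proof -
    have "F' (fst v *\<^sub>R (1, 0) + snd v *\<^sub>R (0, 1)) = fst v * F' (1, 0) + snd v * F' (0, 1)"
      using has_derivative_linear[OF that] by (simp only: linear_add linear_scale real_scaleR_def)
    then show ?thesis by simp
  qed
  show "(c has_derivative (\<lambda>v. - (snd v * frechet_derivative g (at q) (1, 0) * s q))) (at q)"
    using lin[OF has_derivative_c_s(1)[OF q]] c_s_x(1)[OF q] c_s_y(1)[OF q]
    by (intro has_derivative_eq_rhs[OF has_derivative_c_s(1)[OF q]]) auto
  show "(s has_derivative (\<lambda>v. snd v * frechet_derivative g (at q) (1, 0) * c q)) (at q)"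
    using lin[OF has_derivative_c_s(2)[OF q]] c_s_x(2)[OF q] c_s_y(2)[OF q]
    by (intro has_derivative_eq_rhs[OF has_derivative_c_s(2)[OF q]]) auto
  note D = has_derivative_X[OF q]
  have 1: "fst (DX q v) = fst v * c q - snd v * (g q * s q)"
    and 2: "fst (snd (DX q v)) = fst v * s q + snd v * (g q * c q)" for v
    by (subst DX_eq[OF q]; simp add: DX_y_components[OF q] c_def s_def)+
  \<comment> \<open>The third coordinate comes from solving
    \<open>\<Theta> = dz + x dy - y dx\<close> for \<open>dz\<close>.\<close>
  have "contact_form (X q) (DX q v) = snd v * f q" for v
    by (subst DX_eq[OF q]) (simp add: contact_form_linear contact_x[OF q] DX_y_components[OF q])
  then have 3: "snd (snd (DX q v)) = snd v * f q
          + fst (snd (X q)) * (fst v * c q - snd v * (g q * s q))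
          - fst (X q) * (fst v * s q + snd v * (g q * c q))" for v
    unfolding 1[symmetric] 2[symmetric]
    by (simp add: contact_form_def split_beta algebra_simps)
  show "((\<lambda>p. fst (X p)) has_derivative (\<lambda>v. fst v * c q - snd v * (g q * s q))) (at q)"
    using has_derivative_fst[OF D] by (simp add: 1)
  show "((\<lambda>p. fst (snd (X p))) has_derivative (\<lambda>v. fst v * s q + snd v * (g q * c q))) (at q)"
    using has_derivative_fst[OF has_derivative_snd[OF D]] by (simp add: 2)
  show "((\<lambda>p. snd (snd (X p))) has_derivative (\<lambda>v. snd v * f q
          + fst (snd (X q)) * (fst v * c q - snd v * (g q * s q))
          - fst (X q) * (fst v * s q + snd v * (g q * c q)))) (at q)"
    using has_derivative_snd[OF has_derivative_snd[OF D]] by (simp add: 3)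
qed

end

lemma normal_coords_iff:
  "normal_coords I \<alpha> b U X \<longleftrightarrow> U \<subseteq> UNIV \<times> I \<and> (\<exists>e1. surface_in_normal_coords \<alpha> b U X e1)"
  unfolding normal_coords_def surface_in_normal_coords_def by blast

lemma normal_coords_imp_immersion: "normal_coords I \<alpha> b U X \<Longrightarrow> immersion_on U X"
  using surface_in_normal_coords.immersion unfolding normal_coords_iff by blast

section \<open>Rigidity\<close>

text \<open>Rotation, horizontal translation and vertical translation are found in this order. Each
  is a combination of the data of \<open>X\<close> and \<open>Y\<close> whose differential vanishes
  by the structure equations, hence is constant on the connected set \<open>U\<close>.\<close>

lemma normal_coords_part_of:
  assumes X: "normal_coords I \<alpha> b V X" and Y: "normal_coords I \<alpha> b U Y"
    and UV: "U \<subseteq> V" and conn: "connected U"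
  shows "part_of U Y V X"
proof (cases "U = {}")
  case True
  \<comment> \<open>There is no base point in the empty case, but some motion must still be named;
    this one is the identity.\<close>
  have "rigid_motion (heis_motion 1 0 0 0 0)"
    by (rule rigid_motion_heis_motion) simp
  then show ?thesis
    using True unfolding part_of_def by blast
next
  case False
  then obtain q0 where q0: "q0 \<in> U" by blast
  obtain e where "surface_in_normal_coords \<alpha> b V X e"
    using X unfolding normal_coords_iff by blast
  then interpret X: surface_in_normal_coords \<alpha> b V X e .
  obtain e' where "surface_in_normal_coords \<alpha> b U Y e'"
    using Y unfolding normal_coords_iff by blast
  then interpret Y: surface_in_normal_coords \<alpha> b U Y e' .
  have const: "F q = F q0" if "\<And>q. q \<in> U \<Longrightarrow> (F has_derivative (\<lambda>_. 0)) (at q)" "q \<in> U"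
    for F :: "real \<times> real \<Rightarrow> real" and q
    using has_derivative_zero_unique_connected[OF Y.open_U conn that(1) that(2) q0] .
  \<comment> \<open>Inner product and determinant of the two characteristic directions, that is,
    cosine and sine of the angle from that of \<open>X\<close> to that of \<open>Y\<close>. It is
    constant because both directions turn at the same rate, the x-derivative of
    \<open>g\<close>.\<close>
  define u where "u = (\<lambda>q. X.c q * Y.c q + X.s q * Y.s q)"
  define w where "w = (\<lambda>q. X.c q * Y.s q - X.s q * Y.c q)"
  have u: "u q = u q0" if "q \<in> U" for q
  proof (rule const[OF _ that])
    fix q assume q: "q \<in> U"
    then have "q \<in> V" using UV by blast
    note D = X.structure_equations[OF this] Y.structure_equations[OF q]
    show "(u has_derivative (\<lambda>_. 0)) (at q)"
      unfolding u_def by (rule has_derivative_eq_rhs, (rule derivative_intros D)+) (auto simp: algebra_simps)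
  qed
  have w: "w q = w q0" if "q \<in> U" for q
  proof (rule const[OF _ that])
    fix q assume q: "q \<in> U"
    then have "q \<in> V" using UV by blast
    note D = X.structure_equations[OF this] Y.structure_equations[OF q]
    show "(w has_derivative (\<lambda>_. 0)) (at q)"
      unfolding w_def by (rule has_derivative_eq_rhs, (rule derivative_intros D)+) (auto simp: algebra_simps)
  qed
  define u0 where "u0 = u q0"
  define w0 where "w0 = w q0"
  have rot: "Y.c q = u0 * X.c q - w0 * X.s q" "Y.s q = w0 * X.c q + u0 * X.s q" if q: "q \<in> U" for q
  proof -
    have "(X.c q)\<^sup>2 + (X.s q)\<^sup>2 = 1"
      using X.c_s_unit q UV by blast
    moreover have "u0 = X.c q * Y.c q + X.s q * Y.s q" "w0 = X.c q * Y.s q - X.s q * Y.c q"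
      using u[OF q] w[OF q] by (simp_all add: u0_def w0_def u_def w_def)
    ultimately show "Y.c q = u0 * X.c q - w0 * X.s q" "Y.s q = w0 * X.c q + u0 * X.s q"
      by algebra+
  qed
  have uw: "u0\<^sup>2 + w0\<^sup>2 = 1"
  proof -
    have "(X.c q0)\<^sup>2 + (X.s q0)\<^sup>2 = 1" "(Y.c q0)\<^sup>2 + (Y.s q0)\<^sup>2 = 1"
      using X.c_s_unit Y.c_s_unit q0 UV by blast+
    then show ?thesis
      unfolding u0_def w0_def u_def w_def by algebra
  qed
  let ?x = "\<lambda>q. u0 * fst (X q) - w0 * fst (snd (X q))"
  let ?y = "\<lambda>q. w0 * fst (X q) + u0 * fst (snd (X q))"
  define a where "a = fst (Y q0) - ?x q0"
  define b' where "b' = fst (snd (Y q0)) - ?y q0"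
  have a: "fst (Y q) = a + ?x q" if "q \<in> U" for q
  proof -
    have "fst (Y q) - ?x q = a"
      unfolding a_def
    proof (rule const[OF _ that])
      fix q assume q: "q \<in> U"
      then have "q \<in> V" using UV by blast
      note D = X.structure_equations[OF this] Y.structure_equations[OF q]
      show "((\<lambda>q. fst (Y q) - ?x q) has_derivative (\<lambda>_. 0)) (at q)"
        by (rule has_derivative_eq_rhs, (rule has_derivative_diff has_derivative_mult_right D)+)
          (auto simp: rot[OF q] algebra_simps)
    qed
    then show ?thesis by simp
  qed
  have b': "fst (snd (Y q)) = b' + ?y q" if "q \<in> U" for q
  proof -
    have "fst (snd (Y q)) - ?y q = b'"
      unfolding b'_def
    proof (rule const[OF _ that])
      fix q assume q: "q \<in> U"
      then have "q \<in> V" using UV by blast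
      note D = X.structure_equations[OF this] Y.structure_equations[OF q]
      show "((\<lambda>q. fst (snd (Y q)) - ?y q) has_derivative (\<lambda>_. 0)) (at q)"
        by (rule has_derivative_eq_rhs, (rule has_derivative_diff has_derivative_add has_derivative_mult_right D)+)
          (auto simp: rot[OF q] algebra_simps)
    qed
    then show ?thesis by simp
  qed
  \<comment> \<open>The third coordinate of \<open>X\<close> after the rotation and the left
    translation by \<open>(a, b', 0)\<close>.\<close>
  let ?z = "\<lambda>q. snd (snd (X q)) + b' * ?x q - a * ?y q"
  define t where "t = snd (snd (Y q0)) - ?z q0"
  have t: "snd (snd (Y q)) = t + ?z q" if "q \<in> U" for q
  proof -
    have "snd (snd (Y q)) - ?z q = t"
      unfolding t_def
    proof (rule const[OF _ that])
      fix q assume q: "q \<in> U"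
      then have "q \<in> V" using UV by blast
      note D = X.structure_equations[OF this] Y.structure_equations[OF q]
      \<comment> \<open>\<open>f\<close> and \<open>g\<close> depend on \<alpha> and
        \<open>b\<close> only, so the same \<open>X.f\<close> and \<open>X.g\<close> occur in the
        equations of both surfaces. The rest is invariance of the contact form under the motion
        found so far.\<close>
      have eq: "v2 * X.f q + fst (snd (Y q)) * (v1 * Y.c q - v2 * (X.g q * Y.s q))
          - fst (Y q) * (v1 * Y.s q + v2 * (X.g q * Y.c q))
        - (v2 * X.f q + fst (snd (X q)) * (v1 * X.c q - v2 * (X.g q * X.s q))
          - fst (X q) * (v1 * X.s q + v2 * (X.g q * X.c q))
          + b' * (u0 * (v1 * X.c q - v2 * (X.g q * X.s q)) - w0 * (v1 * X.s q + v2 * (X.g q * X.c q)))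
          - a * (w0 * (v1 * X.c q - v2 * (X.g q * X.s q)) + u0 * (v1 * X.s q + v2 * (X.g q * X.c q)))) = 0"
        for v1 v2
        unfolding rot[OF q] a[OF q] b'[OF q] using uw by algebra
      show "((\<lambda>q. snd (snd (Y q)) - ?z q) has_derivative (\<lambda>_. 0)) (at q)"
        by (rule has_derivative_eq_rhs, (rule has_derivative_diff has_derivative_add has_derivative_mult_right D)+)
          (rule ext, rule eq)
    qed
    then show ?thesis by simp
  qed
  have "Y q = heis_motion u0 w0 a b' t (X q)" if "q \<in> U" for q
    using a[OF that] b'[OF that] t[OF that]
    by (auto simp: heis_motion_def prod_eq_iff split_beta)
  then show ?thesis
    using UV rigid_motion_heis_motion[OF uw] unfolding part_of_def by blast
qed

section \<open>Existence\<close>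

text \<open>The characteristic lines are straight and make the angle \<open>k * y\<close> with \<open>heis_E1\<close>; here
  \<open>1 / (b * sqrt (1 + \<alpha>\<^sup>2))\<close> and \<open>\<alpha>\<close> times this quantity are the \<open>T\<close>- and \<open>e2\<close>-components of
  \<open>\<partial>X / \<partial>y\<close>, and integrability forces them to be of the form below.\<close>

lemma normal_coords_exist:
  fixes l r :: ereal and k :: real and m n :: "real \<Rightarrow> real"
  defines "I \<equiv> einterval l r"
  assumes lr: "l < r" and m: "smooth_on I m" and n: "smooth_on I n"
    and V: "open V" "V \<subseteq> UNIV \<times> I"
    and b: "\<And>q. q \<in> V \<Longrightarrow> b q > 0"
    and f: "\<And>x y. (x, y) \<in> V \<Longrightarrow> 1 / (b (x, y) * sqrt (1 + (\<alpha> (x, y))\<^sup>2)) = k * x\<^sup>2 + 2 * m y * x + n y"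
    and g: "\<And>x y. (x, y) \<in> V \<Longrightarrow> \<alpha> (x, y) * (k * x\<^sup>2 + 2 * m y * x + n y) = k * x + m y"
  shows "\<exists>X. normal_coords I \<alpha> b V X"
proof -
  have I: "open I" by (simp add: I_def)
  have lin: "smooth_on I (\<lambda>y. k * y)"
    using I by (intro smooth_on_bounded_linear bounded_linear_mult_right)
  \<comment> \<open>\<open>(P, Q)\<close> is the horizontal projection of the curve
    \<open>x = 0\<close>: there \<open>g = m y\<close>, and the y-derivative is \<open>m y\<close>
    times the direction at angle \<open>k * y + pi / 2\<close>.\<close>
  have "smooth_on I (\<lambda>y. - (m y * sin (k * y)))"
    by (intro smooth_on_minus smooth_on_mult smooth_on_sin m lin)
  then obtain P
    where P: "\<And>y. y \<in> I \<Longrightarrow> (P has_real_derivative - (m y * sin (k * y))) (at y)" "smooth_on I P"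
    unfolding I_def by (rule smooth_antiderivative_exists[OF lr]) blast
  have "smooth_on I (\<lambda>y. m y * cos (k * y))"
    by (intro smooth_on_mult smooth_on_cos m lin)
  then obtain Q
    where Q: "\<And>y. y \<in> I \<Longrightarrow> (Q has_real_derivative m y * cos (k * y)) (at y)" "smooth_on I Q"
    unfolding I_def by (rule smooth_antiderivative_exists[OF lr]) blast
  \<comment> \<open>\<open>R\<close> is the height over the same curve: its derivative is
    \<open>f = n y\<close> at \<open>x = 0\<close>, plus \<open>Q * P' - P * Q'\<close>.\<close>
  have "smooth_on I (\<lambda>y. n y - m y * (P y * cos (k * y) + Q y * sin (k * y)))"
    by (intro smooth_on_diff smooth_on_add smooth_on_mult smooth_on_cos smooth_on_sin m n P Q lin)
  then obtain R
    where R: "\<And>y. y \<in> I \<Longrightarrow> (R has_real_derivative n y - m y * (P y * cos (k * y) + Q y * sin (k * y))) (at y)"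
      "smooth_on I R"
    unfolding I_def by (rule smooth_antiderivative_exists[OF lr]) blast
  \<comment> \<open>From each point \<open>(P, Q, R)\<close> the horizontal line in direction
    \<open>cos (k * y)\<close>, \<open>sin (k * y)\<close> is followed for length \<open>x\<close>.
    Along it the slope of the third coordinate is constant, since the terms containing
    \<open>x\<close> cancel.\<close>
  define X1 where "X1 = (\<lambda>q. fst q * cos (k * snd q) + P (snd q))"
  define X2 where "X2 = (\<lambda>q. fst q * sin (k * snd q) + Q (snd q))"
  define X3 where "X3 = (\<lambda>q. fst q * (Q (snd q) * cos (k * snd q) - P (snd q) * sin (k * snd q)) + R (snd q))"
  define X where "X = (\<lambda>q. (X1 q, X2 q, X3 q))"
  have fst: "smooth_on V (fst :: real \<times> real \<Rightarrow> real)" and snd: "smooth_on V (snd :: real \<times> real \<Rightarrow> real)"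
    using V by (auto intro: smooth_on_bounded_linear bounded_linear_fst bounded_linear_snd)
  have comp: "smooth_on V (\<lambda>q. h (snd q))" if "smooth_on I h" for h :: "real \<Rightarrow> real"
    by (rule smooth_on_compose[OF that snd]) (use V in auto)
  have X: "smooth_on V X"
    unfolding X_def X1_def X2_def X3_def
    by (intro smooth_on_intros fst snd V comp[OF P(2)] comp[OF Q(2)] comp[OF R(2)])
  \<comment> \<open>\<open>F\<close> and \<open>G\<close> are the prescribed \<open>f\<close> and
    \<open>g\<close>, but as polynomials in x, defined without reference to \<alpha> and
    \<open>b\<close>.\<close>
  define F where "F = (\<lambda>q::real \<times> real. k * (fst q)\<^sup>2 + 2 * m (snd q) * fst q + n (snd q))"
  define G where "G = (\<lambda>q::real \<times> real. k * fst q + m (snd q))"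
  define D1 where "D1 = (\<lambda>q v. fst v * cos (k * snd q) - snd v * (G q * sin (k * snd q)))"
  define D2 where "D2 = (\<lambda>q v. fst v * sin (k * snd q) + snd v * (G q * cos (k * snd q)))"
  \<comment> \<open>Chosen so that the contact form of \<open>DX q v\<close> is
    \<open>snd v * F q\<close>.\<close>
  define D3 where "D3 = (\<lambda>q v. snd v * F q + X2 q * D1 q v - X1 q * D2 q v)"
  define DX where "DX = (\<lambda>q v. (D1 q v, D2 q v, D3 q v))"
  have DX: "(X has_derivative DX q) (at q)" if q: "q \<in> V" for q
  proof -
    have y: "snd q \<in> I" using q V by auto
    have comp: "((\<lambda>q. h (snd q)) has_derivative (\<lambda>v. snd v * h')) (at q)"
      if "(h has_real_derivative h') (at (snd q))" for h h'
      using DERIV_compose_FDERIV[OF that has_derivative_snd[OF has_derivative_ident]] .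
    note D = comp[OF P(1)[OF y]] comp[OF Q(1)[OF y]] comp[OF R(1)[OF y]]
    have "(X1 has_derivative D1 q) (at q)" "(X2 has_derivative D2 q) (at q)"
      unfolding X1_def X2_def D1_def D2_def G_def
      by (rule derivative_eq_intros D refl ext | simp add: algebra_simps)+
    moreover have "(X3 has_derivative D3 q) (at q)"
    proof -
      have cs: "sin (k * snd q) * sin (k * snd q) + cos (k * snd q) * cos (k * snd q) = 1"
        using sin_cos_squared_add[of "k * snd q"] by (simp add: power2_eq_square)
      \<comment> \<open>This is the raw outcome of the product rule. It agrees with
        \<open>D3\<close> because \<open>F - x * G = m * x + n\<close>, once the squares of sine and
        cosine are combined.\<close>
      have "(X3 has_derivative (\<lambda>v. fst q * (Q (snd q) * - (k * snd v * sin (k * snd q))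
            + snd v * (m (snd q) * cos (k * snd q)) * cos (k * snd q)
            - (P (snd q) * (k * snd v * cos (k * snd q))
              + snd v * - (m (snd q) * sin (k * snd q)) * sin (k * snd q)))
          + fst v * (Q (snd q) * cos (k * snd q) - P (snd q) * sin (k * snd q))
          + snd v * (n (snd q) - m (snd q) * (P (snd q) * cos (k * snd q) + Q (snd q) * sin (k * snd q))))) (at q)"
        unfolding X3_def
        by (rule derivative_eq_intros D refl ext | simp)+
      then show ?thesis
      proof (rule has_derivative_eq_rhs, intro ext)
        fix v
        show "fst q * (Q (snd q) * - (k * snd v * sin (k * snd q))
            + snd v * (m (snd q) * cos (k * snd q)) * cos (k * snd q)
            - (P (snd q) * (k * snd v * cos (k * snd q))
              + snd v * - (m (snd q) * sin (k * snd q)) * sin (k * snd q)))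
          + fst v * (Q (snd q) * cos (k * snd q) - P (snd q) * sin (k * snd q))
          + snd v * (n (snd q) - m (snd q) * (P (snd q) * cos (k * snd q) + Q (snd q) * sin (k * snd q)))
          = D3 q v"
          unfolding D3_def D1_def D2_def X1_def X2_def F_def G_def using cs by algebra
      qed
    qed
    ultimately show ?thesis
      unfolding X_def DX_def by (intro has_derivative_Pair)
  qed
  have DX_eq: "frechet_derivative X (at q) = DX q" if "q \<in> V" for q
    using frechet_derivative_at[OF DX[OF that]] by simp
  have contact: "contact_form (X q) (DX q v) = snd v * F q" for q v
    by (simp add: contact_form_def X_def DX_def D3_def)
  have alpha: "F q = 1 / (b q * sqrt (1 + (\<alpha> q)\<^sup>2))" "\<alpha> q * F q = G q" if "q \<in> V" for q
    using f[of "fst q" "snd q"] g[of "fst q" "snd q"] that by (simp_all add: F_def G_def)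
  have F_pos: "F q > 0" if "q \<in> V" for q
    using b[OF that] alpha(1)[OF that] by (simp add: add_pos_nonneg)
  have regular: "\<not> singular_at X q" if "q \<in> V" for q
    using singular_at_contact_form[of X q "(0, 1)"] contact[of q "(0, 1)"] F_pos[OF that]
    by (auto simp: DX_eq[OF that])
  have DX_y: "DX q (0, 1) = F q *\<^sub>R (\<alpha> q *\<^sub>R heis_J (X q) (DX q (1, 0)) + heis_T)" if "q \<in> V" for q
    using alpha(2)[OF that, symmetric]
    by (simp add: heis_J_def heis_E1_def heis_E2_def heis_T_def frame_coef1_def frame_coef2_def
        DX_def D1_def D2_def D3_def X_def algebra_simps)
  have "compatible_coords V X (\<lambda>q. frechet_derivative X (at q) (1, 0)) \<alpha> (\<lambda>_. 0) b"
    unfolding compatible_coords_def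
  proof (intro conjI ballI)
    show "characteristic_field V X (\<lambda>q. frechet_derivative X (at q) (1, 0))"
      unfolding characteristic_field_def
    proof (intro conjI ballI smooth_on_frechet_derivative X)
      fix q assume q: "q \<in> V"
      show "frechet_derivative X (at q) (1, 0) \<in> tangent_plane X q \<inter> contact_plane (X q)"
        by (simp add: tangent_plane_def contact_plane_def DX_eq[OF q] contact)
      show "heis_metric (X q) (frechet_derivative X (at q) (1, 0)) (frechet_derivative X (at q) (1, 0)) = 1"
        using sin_cos_squared_add2[of "k * snd q"] contact[of q "(1, 0)"]
        by (simp add: heis_metric_def DX_eq[OF q] frame_coef1_def frame_coef2_def DX_def D1_def D2_def
            power2_eq_square)
    qed
    show "alpha_function V X (\<lambda>q. frechet_derivative X (at q) (1, 0)) \<alpha>"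
      unfolding alpha_function_def
    proof
      fix q assume q: "q \<in> V"
      have "\<alpha> q *\<^sub>R heis_J (X q) (DX q (1, 0)) + heis_T = (1 / F q) *\<^sub>R DX q (0, 1)"
        using DX_y[OF q] F_pos[OF q] by simp
      also have "\<dots> = DX q ((1 / F q) *\<^sub>R (0, 1))"
        using linear_scale[OF has_derivative_linear[OF DX[OF q]]] by metis
      finally show "\<alpha> q *\<^sub>R heis_J (X q) (frechet_derivative X (at q) (1, 0)) + heis_T \<in> tangent_plane X q"
        by (simp add: tangent_plane_def DX_eq[OF q])
    qed
    fix q assume q: "q \<in> V"
    \<comment> \<open>\<open>b q * F q\<close> is exactly the normalising factor
      \<open>1 / sqrt (1 + (\<alpha> q)\<^sup>2)\<close>.\<close>
    have "e2_hat X (\<lambda>q. frechet_derivative X (at q) (1, 0)) \<alpha> q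
        = (b q * F q) *\<^sub>R (\<alpha> q *\<^sub>R heis_J (X q) (DX q (1, 0)) + heis_T)"
      using b[OF q] alpha(1)[OF q] by (simp add: e2_hat_def DX_eq[OF q])
    also have "\<dots> = b q *\<^sub>R DX q (0, 1)"
      by (simp add: DX_y[OF q])
    also have "\<dots> = DX q (b q *\<^sub>R (0, 1))"
      using linear_scale[OF has_derivative_linear[OF DX[OF q]]] by metis
    finally show "e2_hat X (\<lambda>q. frechet_derivative X (at q) (1, 0)) \<alpha> q = frechet_derivative X (at q) (0, b q)"
      by (simp add: DX_eq[OF q])
    show "b q > 0" using b[OF q] .
  qed (simp add: DX_eq)
  moreover have "p_minimal_on V X"
    unfolding p_minimal_on_def
  proof (intro allI impI)
    fix W e
    assume "open W \<and> W \<subseteq> {q \<in> V. \<not> singular_at X q} \<and> characteristic_field W X e"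
    then have W: "open W" "W \<subseteq> V" and e: "smooth_on W e"
      "\<And>q. q \<in> W \<Longrightarrow> e q \<in> tangent_plane X q" "\<And>q. q \<in> W \<Longrightarrow> contact_form (X q) (e q) = 0"
      "\<And>q. q \<in> W \<Longrightarrow> heis_metric (X q) (e q) (e q) = 1"
      by (auto simp: characteristic_field_def contact_plane_def)
    \<comment> \<open>P-minimality concerns every characteristic field \<open>e\<close> on every
      open piece. Such a field is plus or minus the x-derivative of \<open>X\<close>, and \<sigma>
      is this sign, written as an inner product to make it visibly smooth.\<close>
    define \<sigma> where "\<sigma> = (\<lambda>q. frame_coef1 (e q) * cos (k * snd q) + frame_coef2 (e q) * sin (k * snd q))"
    have \<sigma>: "e q = DX q (\<sigma> q, 0)" "(\<sigma> q)\<^sup>2 = 1" if q: "q \<in> W" for q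
    proof -
      obtain v where v: "e q = DX q v"
        using e(2)[OF q] DX_eq[of q] W(2) q unfolding tangent_plane_def by auto
      then have "snd v = 0"
        using e(3)[OF q] contact[of q v] F_pos[of q] q W by auto
      then have *: "frame_coef1 (e q) = fst v * cos (k * snd q)" "frame_coef2 (e q) = fst v * sin (k * snd q)"
        by (simp_all add: v frame_coef1_def frame_coef2_def DX_def D1_def D2_def)
      have cs: "cos (k * snd q) * cos (k * snd q) + sin (k * snd q) * sin (k * snd q) = 1"
        using sin_cos_squared_add2[of "k * snd q"] by (simp add: power2_eq_square)
      have "\<sigma> q = fst v"
        unfolding \<sigma>_def * using cs by algebra
      then show "e q = DX q (\<sigma> q, 0)"
        using v \<open>snd v = 0\<close> by (cases v) simp
      have "(fst v)\<^sup>2 = frame_coef1 (e q) * frame_coef1 (e q) + frame_coef2 (e q) * frame_coef2 (e q)"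
        unfolding * using cs by algebra
      then show "(\<sigma> q)\<^sup>2 = 1"
        using e(4)[OF q] e(3)[OF q] \<open>\<sigma> q = fst v\<close> by (simp add: heis_metric_def)
    qed
    show "p_mean_curvature W X e (\<lambda>_. 0)"
      unfolding p_mean_curvature_def
    proof (intro ballI allI impI)
      fix q w
      assume q: "q \<in> W" and w: "frechet_derivative X (at q) w = e q"
      have qV: "q \<in> V" using q W by blast
      \<comment> \<open>A horizontal tangent vector has no y-component, and the angle
        \<open>k * y\<close> does not vary in the x-direction; so nothing but \<sigma> could change
        along \<open>w\<close>.\<close>
      have "snd w * F q = 0"
        using w e(3)[OF q] contact[of q w] by (simp add: DX_eq[OF qV])
      then have w0: "snd w = 0"
        using F_pos[OF qV] by simp
      have "smooth_on W \<sigma>"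
      proof -
        have "smooth_on W (\<lambda>q. frame_coef1 (e q))" "smooth_on W (\<lambda>q. frame_coef2 (e q))"
          unfolding frame_coef1_def frame_coef2_def
          by (rule smooth_on_bounded_linear_compose[OF bounded_linear_fst e(1)],
            rule smooth_on_bounded_linear_compose[OF bounded_linear_fst
              smooth_on_bounded_linear_compose[OF bounded_linear_snd e(1)]])
        moreover have "smooth_on W (snd :: real \<times> real \<Rightarrow> real)"
          using W(1) by (intro smooth_on_bounded_linear bounded_linear_snd)
        ultimately show ?thesis
          unfolding \<sigma>_def by (intro smooth_on_intros W(1))
      qed
      then obtain \<sigma>' where \<sigma>': "(\<sigma> has_derivative \<sigma>') (at q)"
        using smooth_on_has_derivative q by blast
      \<comment> \<open>Differentiating \<open>(\<sigma> q)\<^sup>2 = 1\<close> shows that the sign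
        is locally constant.\<close>
      have "((\<lambda>q. (\<sigma> q)\<^sup>2) has_derivative (\<lambda>v. 2 * \<sigma> q * \<sigma>' v)) (at q)"
        using has_derivative_power[OF \<sigma>', of 2] by (simp add: mult_ac)
      moreover have "((\<lambda>q. (\<sigma> q)\<^sup>2) has_derivative (\<lambda>v. 0)) (at q)"
        by (rule has_derivative_transform_within_open[OF has_derivative_const[of 1] W(1) q]) (simp add: \<sigma>)
      ultimately have "2 * \<sigma> q * \<sigma>' v = 0" for v
        using has_derivative_unique by metis
      moreover have "\<sigma> q \<noteq> 0"
        using \<sigma>(2)[OF q] by auto
      ultimately have \<sigma>'0: "\<sigma>' = (\<lambda>v. 0)"
        by auto
      have J: "heis_J (X p) (e p) = - (\<sigma> p * sin (k * snd p)) *\<^sub>R heis_E1 (X p) + (\<sigma> p * cos (k * snd p)) *\<^sub>R heis_E2 (X p)"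
        if "p \<in> W" for p
        using \<sigma>(1)[OF that]
        by (simp add: heis_J_def frame_coef1_def frame_coef2_def DX_def D1_def D2_def)
      have J1: "- (\<sigma> p * sin (k * snd p)) = frame_coef1 (heis_J (X p) (e p))"
        and J2: "\<sigma> p * cos (k * snd p) = frame_coef2 (heis_J (X p) (e p))"
        and J3: "0 = contact_form (X p) (heis_J (X p) (e p))" if "p \<in> W" for p
        using J[OF that]
        by (simp_all add: X_def heis_E1_def heis_E2_def frame_coef1_def frame_coef2_def contact_form_def
            algebra_simps)
      have "((\<lambda>p. - (\<sigma> p * sin (k * snd p))) has_derivative (\<lambda>v. - (\<sigma> q * (cos (k * snd q) * (k * snd v))))) (at q)"
        unfolding \<sigma>'0 using \<sigma>'[unfolded \<sigma>'0] by (auto intro!: derivative_eq_intros)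
      from frechet_derivative_at_eq[OF has_derivative_transform_within_open[OF this W(1) q J1], of w]
      have 1: "frechet_derivative (\<lambda>p. frame_coef1 (heis_J (X p) (e p))) (at q) w = 0"
        using w0 by simp
      have "((\<lambda>p. \<sigma> p * cos (k * snd p)) has_derivative (\<lambda>v. - (\<sigma> q * (sin (k * snd q) * (k * snd v))))) (at q)"
        unfolding \<sigma>'0 using \<sigma>'[unfolded \<sigma>'0] by (auto intro!: derivative_eq_intros)
      from frechet_derivative_at_eq[OF has_derivative_transform_within_open[OF this W(1) q J2], of w]
      have 2: "frechet_derivative (\<lambda>p. frame_coef2 (heis_J (X p) (e p))) (at q) w = 0"
        using w0 by simp
      from frechet_derivative_at_eq[OF has_derivative_transform_within_open[OF has_derivative_const W(1) q J3], where v = w]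
      have 3: "frechet_derivative (\<lambda>p. contact_form (X p) (heis_J (X p) (e p))) (at q) w = 0"
        by simp
      show "cov_deriv X (\<lambda>s. heis_J (X s) (e s)) q w = - 0 *\<^sub>R e q"
        unfolding cov_deriv_def 1 2 3 by simp
    qed
  qed
  ultimately show ?thesis
    unfolding normal_coords_def using X V regular by blast
qed

section \<open>The eight surfaces\<close>

text \<open>Each maximal domain other than \<open>V_I\<close> lies on one side of a graph or between
  two graphs over \<open>I\<close>; suitable choices of \<open>h\<close> cover all of them.\<close>

lemma open_graph_domain:
  fixes h :: "real \<Rightarrow> real"
  assumes "open I" "continuous_on I h"
  shows "open {(x, y). y \<in> I \<and> x + h y < 0}" "open {(x, y). y \<in> I \<and> x + h y > 0}"
proof -
  have "continuous_on (UNIV \<times> I) (\<lambda>q. fst q + h (snd q))"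
    by (intro continuous_intros continuous_on_compose2[OF assms(2)]) auto
  moreover have "open (UNIV \<times> I)"
    using assms(1) by (intro open_Times) auto
  ultimately have "open ((\<lambda>q. fst q + h (snd q)) -` A \<inter> UNIV \<times> I)" if "open A" for A
    using that by (metis continuous_on_open_vimage)
  moreover have "{(x, y). y \<in> I \<and> x + h y < 0} = (\<lambda>q. fst q + h (snd q)) -` {..<0} \<inter> UNIV \<times> I"
    "{(x, y). y \<in> I \<and> x + h y > 0} = (\<lambda>q. fst q + h (snd q)) -` {0<..} \<inter> UNIV \<times> I"
    by auto
  ultimately show "open {(x, y). y \<in> I \<and> x + h y < 0}" "open {(x, y). y \<in> I \<and> x + h y > 0}"
    by simp_all
qed

text \<open>Intermediate value theorem; it decides which of two maximal domains contains a connected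
  surface.\<close>

lemma connected_sign:
  fixes h :: "'a::topological_space \<Rightarrow> real"
  assumes "connected U" "continuous_on U h" "\<And>q. q \<in> U \<Longrightarrow> h q \<noteq> 0"
  shows "(\<forall>q\<in>U. h q < 0) \<or> (\<forall>q\<in>U. h q > 0)"
proof (rule ccontr)
  assume "\<not> ?thesis"
  then obtain p q where "p \<in> U" "h p \<le> 0" "q \<in> U" "0 \<le> h q"
    by (meson not_less)
  moreover have "connected (h ` U)"
    by (rule connected_continuous_image[OF assms(2,1)])
  ultimately have "0 \<in> h ` U"
    by (meson connectedD_interval imageI)
  then show False
    using assms(3) by force
qed

section \<open>Existence for the three shapes of \<alpha>\<close>

lemma special_type_I_exists:
  assumes "l < r" "smooth_on (einterval l r) \<zeta>" "open V" "V \<subseteq> UNIV \<times> einterval l r"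
    "\<And>x y. (x, y) \<in> V \<Longrightarrow> x + \<zeta> y \<noteq> 0"
  shows "\<exists>X. special_type_I (einterval l r) \<zeta> V X"
proof -
  let ?\<alpha> = "\<lambda>(x, y). 1 / (x + \<zeta> y)"
  have "\<exists>X. normal_coords (einterval l r) ?\<alpha> (\<lambda>q. (?\<alpha> q)\<^sup>2 / sqrt (1 + (?\<alpha> q)\<^sup>2)) V X"
  \<comment> \<open>Here \<open>f = 1 / \<alpha>\<^sup>2 = (x + \<zeta>)\<^sup>2\<close> and
    \<open>g = \<alpha> * f = x + \<zeta>\<close>; expanding the square gives \<open>k\<close>,
    \<open>m\<close> and \<open>n\<close>.\<close>
  proof (rule normal_coords_exist[where k = 1 and m = \<zeta> and n = "\<lambda>y. \<zeta> y * \<zeta> y"])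
    fix q assume "q \<in> V"
    then show "0 < (?\<alpha> q)\<^sup>2 / sqrt (1 + (?\<alpha> q)\<^sup>2)"
      using assms(5) by (cases q) (simp add: add_pos_nonneg)
  next
    fix x y assume "(x, y) \<in> V"
    then have nz: "x + \<zeta> y \<noteq> 0" by (rule assms(5))
    have sq: "x\<^sup>2 + 2 * \<zeta> y * x + \<zeta> y * \<zeta> y = (x + \<zeta> y)\<^sup>2"
      by (simp add: power2_eq_square algebra_simps)
    have "sqrt (1 + (1 / (x + \<zeta> y))\<^sup>2) \<noteq> 0"
      by (metis add_pos_nonneg less_irrefl real_sqrt_eq_zero_cancel_iff zero_le_power2 zero_less_one)
    then show "1 / ((?\<alpha> (x, y))\<^sup>2 / sqrt (1 + (?\<alpha> (x, y))\<^sup>2) * sqrt (1 + (?\<alpha> (x, y))\<^sup>2))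
        = 1 * x\<^sup>2 + 2 * \<zeta> y * x + \<zeta> y * \<zeta> y"
      using sq by (simp add: power_one_over)
    show "?\<alpha> (x, y) * (1 * x\<^sup>2 + 2 * \<zeta> y * x + \<zeta> y * \<zeta> y) = 1 * x + \<zeta> y"
      using nz sq by (simp add: power2_eq_square)
  qed (use assms in \<open>auto intro: smooth_on_mult\<close>)
  then show ?thesis
    using assms(5) unfolding special_type_I_def Let_def by auto
qed

lemma special_type_II_exists:
  assumes "l < r" "smooth_on (einterval l r) \<zeta>" "open V" "V \<subseteq> UNIV \<times> einterval l r"
    "\<epsilon> = 1 \<or> \<epsilon> = - 1" "\<And>x y. (x, y) \<in> V \<Longrightarrow> \<epsilon> * (2 * x + \<zeta> y) > 0"
  shows "\<exists>X. special_type_II (einterval l r) \<zeta> V X"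
proof -
  let ?\<alpha> = "\<lambda>(x, y). 1 / (2 * x + \<zeta> y)"
  have nz: "2 * x + \<zeta> y \<noteq> 0" if "(x, y) \<in> V" for x y
    using assms(6)[OF that] by auto
  have "\<exists>X. normal_coords (einterval l r) ?\<alpha> (\<lambda>q. \<bar>?\<alpha> q\<bar> / sqrt (1 + (?\<alpha> q)\<^sup>2)) V X"
  \<comment> \<open>Here \<open>f = 1 / \<bar>\<alpha>\<bar> = \<epsilon> * (2 * x +
    \<zeta>)\<close> with \<epsilon> the sign of \<alpha>, and \<open>g = \<epsilon>\<close>. So
    \<open>k = 0\<close>, and all characteristic lines project to parallel lines.\<close>
  proof (rule normal_coords_exist[where k = 0 and m = "\<lambda>_. \<epsilon>" and n = "\<lambda>y. \<epsilon> * \<zeta> y"])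
    fix q assume "q \<in> V"
    then show "0 < \<bar>?\<alpha> q\<bar> / sqrt (1 + (?\<alpha> q)\<^sup>2)"
      using nz by (cases q) (simp add: add_pos_nonneg)
  next
    fix x y assume V: "(x, y) \<in> V"
    have abs: "\<bar>2 * x + \<zeta> y\<bar> = \<epsilon> * (2 * x + \<zeta> y)"
      using assms(5) assms(6)[OF V] by auto
    have "sqrt (1 + (1 / (2 * x + \<zeta> y))\<^sup>2) \<noteq> 0"
      by (metis add_pos_nonneg less_irrefl real_sqrt_eq_zero_cancel_iff zero_le_power2 zero_less_one)
    then have "1 / (\<bar>?\<alpha> (x, y)\<bar> / sqrt (1 + (?\<alpha> (x, y))\<^sup>2) * sqrt (1 + (?\<alpha> (x, y))\<^sup>2)) = \<bar>2 * x + \<zeta> y\<bar>"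
      by (simp add: abs_divide)
    then show "1 / (\<bar>?\<alpha> (x, y)\<bar> / sqrt (1 + (?\<alpha> (x, y))\<^sup>2) * sqrt (1 + (?\<alpha> (x, y))\<^sup>2))
        = 0 * x\<^sup>2 + 2 * \<epsilon> * x + \<epsilon> * \<zeta> y"
      unfolding abs by (simp add: algebra_simps)
    show "?\<alpha> (x, y) * (0 * x\<^sup>2 + 2 * \<epsilon> * x + \<epsilon> * \<zeta> y) = 0 * x + \<epsilon>"
      using nz[OF V] by (simp add: field_simps)
  qed (use assms in \<open>auto intro: smooth_on_minus smooth_on_const\<close>)
  then show ?thesis
    using nz unfolding special_type_II_def Let_def by auto
qed

lemma general_type_exists:
  assumes "l < r" "smooth_on (einterval l r) \<zeta>1" "smooth_on (einterval l r) \<zeta>2"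
    "open V" "V \<subseteq> UNIV \<times> einterval l r" "\<epsilon> = 1 \<or> \<epsilon> = - 1"
    "\<And>x y. (x, y) \<in> V \<Longrightarrow> \<epsilon> * ((x + \<zeta>1 y)\<^sup>2 + \<zeta>2 y) > 0"
    "\<And>y. y \<in> einterval l r \<Longrightarrow> \<zeta>2 y \<noteq> 0"
  shows "\<exists>X. general_type (einterval l r) \<zeta>1 \<zeta>2 V X"
proof -
  let ?\<alpha> = "\<lambda>(x, y). (x + \<zeta>1 y) / ((x + \<zeta>1 y)\<^sup>2 + \<zeta>2 y)"
  let ?b = "\<lambda>(x, y). 1 / (\<bar>(x + \<zeta>1 y)\<^sup>2 + \<zeta>2 y\<bar> * sqrt (1 + (?\<alpha> (x, y))\<^sup>2))"
  have nz: "(x + \<zeta>1 y)\<^sup>2 + \<zeta>2 y \<noteq> 0" if "(x, y) \<in> V" for x y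
    using assms(7)[OF that] by auto
  have "\<exists>X. normal_coords (einterval l r) ?\<alpha> ?b V X"
  \<comment> \<open>Here \<open>f\<close> is the absolute value of
    \<open>(x + \<zeta>1)\<^sup>2 + \<zeta>2\<close>, whose sign on \<open>V\<close> is \<epsilon>,
    and \<open>g = \<epsilon> * (x + \<zeta>1)\<close>; hence the factor \<epsilon> in all three
    coefficients.\<close>
  proof (rule normal_coords_exist[where k = \<epsilon> and m = "\<lambda>y. \<epsilon> * \<zeta>1 y" and n = "\<lambda>y. \<epsilon> * (\<zeta>1 y * \<zeta>1 y + \<zeta>2 y)"])
    fix q assume "q \<in> V"
    then show "0 < ?b q"
      using nz by (cases q) (simp add: add_pos_nonneg)
  next
    fix x y assume V: "(x, y) \<in> V"
    define D where "D = (x + \<zeta>1 y)\<^sup>2 + \<zeta>2 y"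
    have D: "D \<noteq> 0" "\<bar>D\<bar> = \<epsilon> * D"
      using assms(6) assms(7)[OF V] by (auto simp: D_def)
    have sq: "\<epsilon> * x\<^sup>2 + 2 * (\<epsilon> * \<zeta>1 y) * x + \<epsilon> * (\<zeta>1 y * \<zeta>1 y + \<zeta>2 y) = \<epsilon> * D"
      by (simp add: D_def power2_eq_square algebra_simps)
    have "sqrt (1 + ((x + \<zeta>1 y) / D)\<^sup>2) \<noteq> 0"
      by (metis add_pos_nonneg less_irrefl real_sqrt_eq_zero_cancel_iff zero_le_power2 zero_less_one)
    then show "1 / (?b (x, y) * sqrt (1 + (?\<alpha> (x, y))\<^sup>2))
        = \<epsilon> * x\<^sup>2 + 2 * (\<epsilon> * \<zeta>1 y) * x + \<epsilon> * (\<zeta>1 y * \<zeta>1 y + \<zeta>2 y)"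
      unfolding sq using D by (simp add: D_def[symmetric])
    show "?\<alpha> (x, y) * (\<epsilon> * x\<^sup>2 + 2 * (\<epsilon> * \<zeta>1 y) * x + \<epsilon> * (\<zeta>1 y * \<zeta>1 y + \<zeta>2 y)) = \<epsilon> * x + \<epsilon> * \<zeta>1 y"
      unfolding sq case_prod_conv D_def[symmetric] using D(1) by (simp add: field_simps)
  qed (use assms in \<open>auto intro!: smooth_on_mult smooth_on_minus smooth_on_diff smooth_on_add smooth_on_const\<close>)
  then show ?thesis
    using nz assms(5,8) unfolding general_type_def Let_def by fast
qed

section \<open>Immersion and rigidity for each type\<close>

lemma special_type_I_immersion: "special_type_I I \<zeta> V X \<Longrightarrow> immersion_on V X"
  unfolding special_type_I_def Let_def using normal_coords_imp_immersion by blast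

lemma special_type_II_immersion: "special_type_II I \<zeta> V X \<Longrightarrow> immersion_on V X"
  unfolding special_type_II_def Let_def using normal_coords_imp_immersion by blast

lemma general_type_immersion: "general_type I \<zeta>1 \<zeta>2 V X \<Longrightarrow> immersion_on V X"
  unfolding general_type_def Let_def using normal_coords_imp_immersion by blast

lemma special_type_I_part_of:
  "special_type_I I \<zeta> V X \<Longrightarrow> special_type_I I \<zeta> U Y \<Longrightarrow> U \<subseteq> V \<Longrightarrow> connected U \<Longrightarrow> part_of U Y V X"
  unfolding special_type_I_def Let_def using normal_coords_part_of by blast

lemma special_type_II_part_of:
  "special_type_II I \<zeta> V X \<Longrightarrow> special_type_II I \<zeta> U Y \<Longrightarrow> U \<subseteq> V \<Longrightarrow> connected U \<Longrightarrow> part_of U Y V X"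
  unfolding special_type_II_def Let_def using normal_coords_part_of by blast

lemma general_type_part_of:
  "general_type I \<zeta>1 \<zeta>2 V X \<Longrightarrow> general_type I \<zeta>1 \<zeta>2 U Y \<Longrightarrow> U \<subseteq> V \<Longrightarrow> connected U \<Longrightarrow> part_of U Y V X"
  unfolding general_type_def Let_def using normal_coords_part_of by blast

lemma parameters_in_strip:
  "special_type_I I \<zeta> U Y \<Longrightarrow> q \<in> U \<Longrightarrow> snd q \<in> I"
  "special_type_II I \<zeta> U Y \<Longrightarrow> q \<in> U \<Longrightarrow> snd q \<in> I"
  "general_type I \<zeta> \<zeta>' U Y \<Longrightarrow> q \<in> U \<Longrightarrow> snd q \<in> I"
  unfolding special_type_I_def special_type_II_def general_type_def normal_coords_def Let_def by auto

text \<open>Taking square roots compares \<open>\<bar>x + z\<bar>\<close> with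
  \<open>sqrt (- w)\<close>. This translates the root inequalities defining the domains into the
  sign \<epsilon> of the quadratic.\<close>

lemma disc_sign:
  fixes x z w :: real
  assumes "w < 0"
  shows "(x + z)\<^sup>2 + w > 0 \<longleftrightarrow> x < - z - sqrt (- w) \<or> x > - z + sqrt (- w)"
    and "(x + z)\<^sup>2 + w < 0 \<longleftrightarrow> - z - sqrt (- w) < x \<and> x < - z + sqrt (- w)"
proof -
  have "(x + z)\<^sup>2 + w > 0 \<longleftrightarrow> sqrt (- w) < \<bar>x + z\<bar>"
    using real_sqrt_less_iff[of "- w" "(x + z)\<^sup>2"] by (simp, linarith)
  then show "(x + z)\<^sup>2 + w > 0 \<longleftrightarrow> x < - z - sqrt (- w) \<or> x > - z + sqrt (- w)"
    using assms by auto
  have "(x + z)\<^sup>2 + w < 0 \<longleftrightarrow> \<bar>x + z\<bar> < sqrt (- w)"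
    using real_sqrt_less_iff[of "(x + z)\<^sup>2" "- w"] by (simp, linarith)
  then show "(x + z)\<^sup>2 + w < 0 \<longleftrightarrow> - z - sqrt (- w) < x \<and> x < - z + sqrt (- w)"
    by auto
qed

theorem theorem1p6:
  fixes c d :: ereal and \<zeta>1 \<zeta>2 :: "real \<Rightarrow> real"
  defines "I \<equiv> einterval c d"
  assumes "c < d" and "smooth_on I \<zeta>1" and "smooth_on I \<zeta>2" and "\<forall>y\<in>I. \<zeta>2 y \<noteq> 0"
  shows "(\<forall>V\<in>{U_I_minus I \<zeta>1, U_I_plus I \<zeta>1}.
       (\<exists>X. special_type_I I \<zeta>1 V X) \<and> (\<forall>X. special_type_I I \<zeta>1 V X \<longrightarrow> immersion_on V X)) \<and>
     (\<forall>V\<in>{U_II_minus I \<zeta>1, U_II_plus I \<zeta>1}.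
       (\<exists>X. special_type_II I \<zeta>1 V X) \<and> (\<forall>X. special_type_II I \<zeta>1 V X \<longrightarrow> immersion_on V X)) \<and>
     ((\<forall>y\<in>I. \<zeta>2 y > 0) \<longrightarrow>
       (\<exists>X. general_type I \<zeta>1 \<zeta>2 (V_I I) X) \<and>
       (\<forall>X. general_type I \<zeta>1 \<zeta>2 (V_I I) X \<longrightarrow> immersion_on (V_I I) X)) \<and>
     ((\<forall>y\<in>I. \<zeta>2 y < 0) \<longrightarrow>
       (\<forall>V\<in>{V_II_minus I \<zeta>1 \<zeta>2, V_II_plus I \<zeta>1 \<zeta>2, V_III I \<zeta>1 \<zeta>2}.
          (\<exists>X. general_type I \<zeta>1 \<zeta>2 V X) \<and> (\<forall>X. general_type I \<zeta>1 \<zeta>2 V X \<longrightarrow> immersion_on V X))) \<and>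
     (\<forall>X\<^sub>m X\<^sub>p U Y.
       special_type_I I \<zeta>1 (U_I_minus I \<zeta>1) X\<^sub>m \<and> special_type_I I \<zeta>1 (U_I_plus I \<zeta>1) X\<^sub>p \<and>
       connected U \<and> immersion_on U Y \<and> special_type_I I \<zeta>1 U Y \<longrightarrow>
       part_of U Y (U_I_minus I \<zeta>1) X\<^sub>m \<or> part_of U Y (U_I_plus I \<zeta>1) X\<^sub>p) \<and>
     (\<forall>X\<^sub>m X\<^sub>p U Y.
       special_type_II I \<zeta>1 (U_II_minus I \<zeta>1) X\<^sub>m \<and> special_type_II I \<zeta>1 (U_II_plus I \<zeta>1) X\<^sub>p \<and>
       connected U \<and> immersion_on U Y \<and> special_type_II I \<zeta>1 U Y \<longrightarrow>
       part_of U Y (U_II_minus I \<zeta>1) X\<^sub>m \<or> part_of U Y (U_II_plus I \<zeta>1) X\<^sub>p) \<and>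
     ((\<forall>y\<in>I. \<zeta>2 y > 0) \<longrightarrow>
       (\<forall>X U Y. general_type I \<zeta>1 \<zeta>2 (V_I I) X \<and>
          connected U \<and> immersion_on U Y \<and> type_I I \<zeta>1 \<zeta>2 U Y \<longrightarrow>
          part_of U Y (V_I I) X)) \<and>
     ((\<forall>y\<in>I. \<zeta>2 y < 0) \<longrightarrow>
       (\<forall>X\<^sub>m X\<^sub>p U Y.
          general_type I \<zeta>1 \<zeta>2 (V_II_minus I \<zeta>1 \<zeta>2) X\<^sub>m \<and>
          general_type I \<zeta>1 \<zeta>2 (V_II_plus I \<zeta>1 \<zeta>2) X\<^sub>p \<and>
          connected U \<and> immersion_on U Y \<and> type_II I \<zeta>1 \<zeta>2 U Y \<longrightarrow>
          part_of U Y (V_II_minus I \<zeta>1 \<zeta>2) X\<^sub>m \<or> part_of U Y (V_II_plus I \<zeta>1 \<zeta>2) X\<^sub>p)) \<and>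
     ((\<forall>y\<in>I. \<zeta>2 y < 0) \<longrightarrow>
       (\<forall>X U Y. general_type I \<zeta>1 \<zeta>2 (V_III I \<zeta>1 \<zeta>2) X \<and>
          connected U \<and> immersion_on U Y \<and> type_III I \<zeta>1 \<zeta>2 U Y \<longrightarrow>
          part_of U Y (V_III I \<zeta>1 \<zeta>2) X))"
proof -

  \<comment> \<open>Openness of the maximal domains\<close>
  have I: "open I" by (simp add: I_def)
  have z1: "continuous_on I \<zeta>1" and z2: "continuous_on I \<zeta>2"
    using assms(3,4) smooth_on_imp_continuous_on by blast+
  have snd_cont: "continuous_on U (\<lambda>q. \<zeta>1 (snd q))" if "\<And>q. q \<in> U \<Longrightarrow> snd q \<in> I" for U :: "(real \<times> real) set"
    by (rule continuous_on_compose2[OF z1 continuous_on_snd[OF continuous_on_id]]) (use that in auto)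
  note ex_I = special_type_I_exists[OF assms(2) assms(3)[unfolded I_def], folded I_def]
    and ex_II = special_type_II_exists[OF assms(2) assms(3)[unfolded I_def], folded I_def]
    and ex_G = general_type_exists[OF assms(2) assms(3,4)[unfolded I_def], folded I_def]
  have nz: "\<And>y. y \<in> I \<Longrightarrow> \<zeta>2 y \<noteq> 0" using assms(5) by blast
  note open_I = open_graph_domain[OF I z1]
  \<comment> \<open>The boundary curves are \<open>x = - h y\<close> for these three
    \<open>h\<close>. The function \<open>sqrt\<close> is extended oddly to negative arguments and
    is continuous everywhere, so the sign of \<zeta>2 does not enter.\<close>
  have "continuous_on I (\<lambda>y. \<zeta>1 y / 2)" "continuous_on I (\<lambda>y. \<zeta>1 y + sqrt (- \<zeta>2 y))"
    "continuous_on I (\<lambda>y. \<zeta>1 y - sqrt (- \<zeta>2 y))"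
    by (auto intro!: continuous_intros z1 z2)
  note open_II = open_graph_domain[OF I this(1)] and open_m = open_graph_domain[OF I this(2)]
    and open_p = open_graph_domain[OF I this(3)]
  have half: "x + z / 2 < 0 \<longleftrightarrow> 2 * x + z < 0" "0 < x + z / 2 \<longleftrightarrow> 0 < 2 * x + z" for x z :: real
    by auto
  have Um: "open (U_II_minus I \<zeta>1)" and Up: "open (U_II_plus I \<zeta>1)"
    using open_II unfolding U_II_minus_def U_II_plus_def half by auto
  have m: "x + (z + s) < 0 \<longleftrightarrow> x < - z - s" "0 < x + (z + s) \<longleftrightarrow> - z - s < x"
    "x + (z - s) < 0 \<longleftrightarrow> x < - z + s" "0 < x + (z - s) \<longleftrightarrow> - z + s < x" for x z s :: real
    by auto
  have Vm: "open (V_II_minus I \<zeta>1 \<zeta>2)" and Vp: "open (V_II_plus I \<zeta>1 \<zeta>2)"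
    using open_m open_p unfolding V_II_minus_def V_II_plus_def m by auto
  have V3: "open (V_III I \<zeta>1 \<zeta>2)"
  proof -
    have "V_III I \<zeta>1 \<zeta>2 = {(x, y). y \<in> I \<and> 0 < x + (\<zeta>1 y + sqrt (- \<zeta>2 y))}
        \<inter> {(x, y). y \<in> I \<and> x + (\<zeta>1 y - sqrt (- \<zeta>2 y)) < 0}"
      unfolding V_III_def m by auto
    then show ?thesis
      using open_Int[OF open_m(2) open_p(1)] by simp
  qed
  show ?thesis
  proof (intro conjI)

    \<comment> \<open>Existence and immersion\<close>
    show "\<forall>V\<in>{U_I_minus I \<zeta>1, U_I_plus I \<zeta>1}.
       (\<exists>X. special_type_I I \<zeta>1 V X) \<and> (\<forall>X. special_type_I I \<zeta>1 V X \<longrightarrow> immersion_on V X)"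
    proof (intro ballI conjI allI impI special_type_I_immersion)
      fix V assume "V \<in> {U_I_minus I \<zeta>1, U_I_plus I \<zeta>1}"
      then show "\<exists>X. special_type_I I \<zeta>1 V X"
        using open_I by (intro ex_I) (auto simp: U_I_minus_def U_I_plus_def)
    qed
    show "\<forall>V\<in>{U_II_minus I \<zeta>1, U_II_plus I \<zeta>1}.
       (\<exists>X. special_type_II I \<zeta>1 V X) \<and> (\<forall>X. special_type_II I \<zeta>1 V X \<longrightarrow> immersion_on V X)"
    proof (intro ballI conjI allI impI special_type_II_immersion)
      fix V assume "V \<in> {U_II_minus I \<zeta>1, U_II_plus I \<zeta>1}"
      then consider "V = U_II_minus I \<zeta>1" | "V = U_II_plus I \<zeta>1" by blast
      then show "\<exists>X. special_type_II I \<zeta>1 V X"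
      proof cases
        case 1
        then show ?thesis
          using Um by (intro ex_II[where \<epsilon> = "- 1"]) (auto simp: U_II_minus_def)
      next
        case 2
        then show ?thesis
          using Up by (intro ex_II[where \<epsilon> = 1]) (auto simp: U_II_plus_def)
      qed
    qed
    show "(\<forall>y\<in>I. \<zeta>2 y > 0) \<longrightarrow>
       (\<exists>X. general_type I \<zeta>1 \<zeta>2 (V_I I) X) \<and>
       (\<forall>X. general_type I \<zeta>1 \<zeta>2 (V_I I) X \<longrightarrow> immersion_on (V_I I) X)"
    proof (intro conjI allI impI general_type_immersion)
      assume "\<forall>y\<in>I. \<zeta>2 y > 0"
      then show "\<exists>X. general_type I \<zeta>1 \<zeta>2 (V_I I) X"
        using I nz by (intro ex_G[where \<epsilon> = 1]) (auto simp: V_I_def open_Times add_nonneg_pos)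
    qed
    show "(\<forall>y\<in>I. \<zeta>2 y < 0) \<longrightarrow>
       (\<forall>V\<in>{V_II_minus I \<zeta>1 \<zeta>2, V_II_plus I \<zeta>1 \<zeta>2, V_III I \<zeta>1 \<zeta>2}.
          (\<exists>X. general_type I \<zeta>1 \<zeta>2 V X) \<and> (\<forall>X. general_type I \<zeta>1 \<zeta>2 V X \<longrightarrow> immersion_on V X))"
    proof (intro ballI conjI allI impI general_type_immersion)
      fix V assume neg: "\<forall>y\<in>I. \<zeta>2 y < 0"
        and "V \<in> {V_II_minus I \<zeta>1 \<zeta>2, V_II_plus I \<zeta>1 \<zeta>2, V_III I \<zeta>1 \<zeta>2}"
      \<comment> \<open>Outside its two roots in x the quadratic is positive, between them negative;
        hence \<epsilon> is 1 on the first two domains and -1 on the third.\<close>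
      then consider "V = V_II_minus I \<zeta>1 \<zeta>2 \<or> V = V_II_plus I \<zeta>1 \<zeta>2" | "V = V_III I \<zeta>1 \<zeta>2" by blast
      then show "\<exists>X. general_type I \<zeta>1 \<zeta>2 V X"
      proof cases
        case 1
        then show ?thesis
          using Vm Vp neg nz
          by (intro ex_G[where \<epsilon> = 1]) (auto simp: V_II_minus_def V_II_plus_def disc_sign(1))
      next
        case 2
        have "(x + \<zeta>1 y)\<^sup>2 + \<zeta>2 y < 0" if "(x, y) \<in> V_III I \<zeta>1 \<zeta>2" for x y
          using that neg disc_sign(2)[of "\<zeta>2 y" x "\<zeta>1 y"] by (auto simp: V_III_def)
        then show ?thesis
          using V3 nz 2 by (intro ex_G[where \<epsilon> = "- 1"]) (force simp: V_III_def)+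
      qed
    qed

    \<comment> \<open>Maximality\<close>
    show "\<forall>X\<^sub>m X\<^sub>p U Y.
       special_type_I I \<zeta>1 (U_I_minus I \<zeta>1) X\<^sub>m \<and> special_type_I I \<zeta>1 (U_I_plus I \<zeta>1) X\<^sub>p \<and>
       connected U \<and> immersion_on U Y \<and> special_type_I I \<zeta>1 U Y \<longrightarrow>
       part_of U Y (U_I_minus I \<zeta>1) X\<^sub>m \<or> part_of U Y (U_I_plus I \<zeta>1) X\<^sub>p"
    proof (intro allI impI, elim conjE)
      fix X\<^sub>m X\<^sub>p U Y
      assume X: "special_type_I I \<zeta>1 (U_I_minus I \<zeta>1) X\<^sub>m" "special_type_I I \<zeta>1 (U_I_plus I \<zeta>1) X\<^sub>p"
        and U: "connected U" and Y: "special_type_I I \<zeta>1 U Y"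
      note strip = parameters_in_strip(1)[OF Y]
      have "(\<forall>q\<in>U. fst q + \<zeta>1 (snd q) < 0) \<or> (\<forall>q\<in>U. fst q + \<zeta>1 (snd q) > 0)"
        using Y by (intro connected_sign[OF U] continuous_intros snd_cont strip)
          (auto simp: special_type_I_def)
      then have "U \<subseteq> U_I_minus I \<zeta>1 \<or> U \<subseteq> U_I_plus I \<zeta>1"
        using strip by (force simp: U_I_minus_def U_I_plus_def)
      then show "part_of U Y (U_I_minus I \<zeta>1) X\<^sub>m \<or> part_of U Y (U_I_plus I \<zeta>1) X\<^sub>p"
        using special_type_I_part_of[OF X(1) Y _ U] special_type_I_part_of[OF X(2) Y _ U] by blast
    qed
    show "\<forall>X\<^sub>m X\<^sub>p U Y.
       special_type_II I \<zeta>1 (U_II_minus I \<zeta>1) X\<^sub>m \<and> special_type_II I \<zeta>1 (U_II_plus I \<zeta>1) X\<^sub>p \<and>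
       connected U \<and> immersion_on U Y \<and> special_type_II I \<zeta>1 U Y \<longrightarrow>
       part_of U Y (U_II_minus I \<zeta>1) X\<^sub>m \<or> part_of U Y (U_II_plus I \<zeta>1) X\<^sub>p"
    proof (intro allI impI, elim conjE)
      fix X\<^sub>m X\<^sub>p U Y
      assume X: "special_type_II I \<zeta>1 (U_II_minus I \<zeta>1) X\<^sub>m" "special_type_II I \<zeta>1 (U_II_plus I \<zeta>1) X\<^sub>p"
        and U: "connected U" and Y: "special_type_II I \<zeta>1 U Y"
      note strip = parameters_in_strip(2)[OF Y]
      have "(\<forall>q\<in>U. 2 * fst q + \<zeta>1 (snd q) < 0) \<or> (\<forall>q\<in>U. 2 * fst q + \<zeta>1 (snd q) > 0)"
        using Y by (intro connected_sign[OF U] continuous_intros snd_cont strip)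
          (auto simp: special_type_II_def)
      then have "U \<subseteq> U_II_minus I \<zeta>1 \<or> U \<subseteq> U_II_plus I \<zeta>1"
        using strip by (force simp: U_II_minus_def U_II_plus_def)
      then show "part_of U Y (U_II_minus I \<zeta>1) X\<^sub>m \<or> part_of U Y (U_II_plus I \<zeta>1) X\<^sub>p"
        using special_type_II_part_of[OF X(1) Y _ U] special_type_II_part_of[OF X(2) Y _ U] by blast
    qed
    show "(\<forall>y\<in>I. \<zeta>2 y > 0) \<longrightarrow>
       (\<forall>X U Y. general_type I \<zeta>1 \<zeta>2 (V_I I) X \<and>
          connected U \<and> immersion_on U Y \<and> type_I I \<zeta>1 \<zeta>2 U Y \<longrightarrow>
          part_of U Y (V_I I) X)"
    proof (intro allI impI, elim conjE)
      fix X U Y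
      assume X: "general_type I \<zeta>1 \<zeta>2 (V_I I) X" and U: "connected U" and "type_I I \<zeta>1 \<zeta>2 U Y"
      then have Y: "general_type I \<zeta>1 \<zeta>2 U Y" by (simp add: type_I_def)
      show "part_of U Y (V_I I) X"
        using parameters_in_strip(3)[OF Y] by (intro general_type_part_of[OF X Y _ U]) (force simp: V_I_def)
    qed
    show "(\<forall>y\<in>I. \<zeta>2 y < 0) \<longrightarrow>
       (\<forall>X\<^sub>m X\<^sub>p U Y.
          general_type I \<zeta>1 \<zeta>2 (V_II_minus I \<zeta>1 \<zeta>2) X\<^sub>m \<and>
          general_type I \<zeta>1 \<zeta>2 (V_II_plus I \<zeta>1 \<zeta>2) X\<^sub>p \<and>
          connected U \<and> immersion_on U Y \<and> type_II I \<zeta>1 \<zeta>2 U Y \<longrightarrow>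
          part_of U Y (V_II_minus I \<zeta>1 \<zeta>2) X\<^sub>m \<or> part_of U Y (V_II_plus I \<zeta>1 \<zeta>2) X\<^sub>p)"
    proof (intro allI impI, elim conjE)
      fix X\<^sub>m X\<^sub>p U Y
      assume X: "general_type I \<zeta>1 \<zeta>2 (V_II_minus I \<zeta>1 \<zeta>2) X\<^sub>m"
          "general_type I \<zeta>1 \<zeta>2 (V_II_plus I \<zeta>1 \<zeta>2) X\<^sub>p"
        and U: "connected U" and II: "type_II I \<zeta>1 \<zeta>2 U Y"
      then have Y: "general_type I \<zeta>1 \<zeta>2 U Y" by (simp add: type_II_def)
      note strip = parameters_in_strip(3)[OF Y]
      have out: "fst q < - \<zeta>1 (snd q) - sqrt (- \<zeta>2 (snd q)) \<or> fst q > - \<zeta>1 (snd q) + sqrt (- \<zeta>2 (snd q))"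
        and pos: "sqrt (- \<zeta>2 (snd q)) > 0" if "q \<in> U" for q
        using II that by (auto simp: type_II_def)
      \<comment> \<open>Outside the roots, \<open>x + \<zeta>1\<close> exceeds
        \<open>sqrt (- \<zeta>2) > 0\<close> in absolute value, so it has no zero on
        \<open>U\<close>. Its sign then selects the same alternative of \<open>out\<close> at every
        point.\<close>
      have "fst q + \<zeta>1 (snd q) \<noteq> 0" if "q \<in> U" for q
        using out[OF that] pos[OF that] by linarith
      then have "(\<forall>q\<in>U. fst q + \<zeta>1 (snd q) < 0) \<or> (\<forall>q\<in>U. fst q + \<zeta>1 (snd q) > 0)"
        by (intro connected_sign[OF U] continuous_intros snd_cont strip)
      then have "U \<subseteq> V_II_minus I \<zeta>1 \<zeta>2 \<or> U \<subseteq> V_II_plus I \<zeta>1 \<zeta>2"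
      proof (rule disj_forward)
        assume "\<forall>q\<in>U. fst q + \<zeta>1 (snd q) < 0"
        then have "fst q < - \<zeta>1 (snd q) - sqrt (- \<zeta>2 (snd q))" if "q \<in> U" for q
          using out[OF that] pos[OF that] that by fastforce
        then show "U \<subseteq> V_II_minus I \<zeta>1 \<zeta>2"
          using strip by (force simp: V_II_minus_def)
      next
        assume "\<forall>q\<in>U. fst q + \<zeta>1 (snd q) > 0"
        then have "fst q > - \<zeta>1 (snd q) + sqrt (- \<zeta>2 (snd q))" if "q \<in> U" for q
          using out[OF that] pos[OF that] that by fastforce
        then show "U \<subseteq> V_II_plus I \<zeta>1 \<zeta>2"
          using strip by (force simp: V_II_plus_def)
      qed
      then show "part_of U Y (V_II_minus I \<zeta>1 \<zeta>2) X\<^sub>m \<or> part_of U Y (V_II_plus I \<zeta>1 \<zeta>2) X\<^sub>p"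
        using general_type_part_of[OF X(1) Y _ U] general_type_part_of[OF X(2) Y _ U] by blast
    qed
    show "(\<forall>y\<in>I. \<zeta>2 y < 0) \<longrightarrow>
       (\<forall>X U Y. general_type I \<zeta>1 \<zeta>2 (V_III I \<zeta>1 \<zeta>2) X \<and>
          connected U \<and> immersion_on U Y \<and> type_III I \<zeta>1 \<zeta>2 U Y \<longrightarrow>
          part_of U Y (V_III I \<zeta>1 \<zeta>2) X)"
    proof (intro allI impI, elim conjE)
      fix X U Y
      assume X: "general_type I \<zeta>1 \<zeta>2 (V_III I \<zeta>1 \<zeta>2) X" and U: "connected U" and III: "type_III I \<zeta>1 \<zeta>2 U Y"
      then have Y: "general_type I \<zeta>1 \<zeta>2 U Y" by (simp add: type_III_def)
      have "U \<subseteq> V_III I \<zeta>1 \<zeta>2"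
        using parameters_in_strip(3)[OF Y] III by (force simp: V_III_def type_III_def)
      then show "part_of U Y (V_III I \<zeta>1 \<zeta>2) X"
        by (rule general_type_part_of[OF X Y _ U])
    qed
  qed
qed

end
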